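(* Let $A$ and $C$ be (discrete) abelian groups. Then the class $Ext_{t}(C,A)$ of all equivalence classes of t-extensions of $A$ by $C$ is a subgroup of $Ext(C,A)$ with respect to the operation defined by $$[E_{1}]+[E_{2}]=[\nabla_{A}(E_{1}\oplus E_{2})\triangle_{C}],$$ where $E_{1}$ and $E_{2}$ are t-extensions of $A$ by $C$, $\triangle_{C}:C\to C\oplus C$, $c\mapsto (c,c)$, is the diagonal homomorphism and $\nabla_{A}:A\oplus A\to A$, $(a_1,a_2)\mapsto a_1+a_2$, is the codiagonal homomorphism.
   Context: All groups are discrete abelian groups, written additively. For a group $G$, $tG$ denotes its maximal torsion subgroup. An extension of $A$ by $C$ is a short exact sequence $0\to A\stackrel{\phi}{\to} B\stackrel{\psi}{\to} C\to 0$. Two extensions $0\to A\stackrel{\phi_1}{\to} B\stackrel{\psi_1}{\to} C\to 0$ and $0\to A\stackrel{\phi_2}{\to} X\stackrel{\psi_2}{\to} C\to 0$ are equivalent if there is an isomorphism $\beta:B\to X$ with $\beta\phi_1=\phi_2$ and $\psi_2\beta=\psi_1$. $Ext(C,A)$ is the group of equivalence classes of extensions of $A$ by $C$ under the Baer sum. An extension $0\to A\stackrel{\phi}{\to} B\stackrel{\psi}{\to} C\to 0$ is a t-extension if the sequence of restricted maps $0\to tA\stackrel{\phi}{\to} tB\stackrel{\psi}{\to} tC\to 0$ is exact. $Ext_t(C,A)$ denotes the set of elements of $Ext(C,A)$ represented by t-extensions. For an extension $E$, $\mu E$ denotes its pushout along a homomorphism $\mu$ out of the left-hand group, and $E\gamma$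 denotes its pullback along a homomorphism $\gamma$ into the right-hand group; $E_1\oplus E_2$ is the componentwise direct sum of extensions, $0\to A\oplus A\to B_1\oplus B_2\to C\oplus C\to 0$. *)

theory Defs
  imports "HOL-Algebra.Weak_Morphisms"
begin

text \<open>
  Abelian groups are objects \<open>G :: 'a monoid\<close> with \<open>comm_group G\<close>, so the additive notation of
  the mathematics turns into the multiplicative notation of HOL-Algebra (\<open>0\<close> is \<open>\<one>\<close>, \<open>-x\<close> is
  \<open>inv x\<close>, \<open>n x\<close> is \<open>x [^] n\<close>).
\<close>

section \<open>The torsion subgroup\<close>

definition torsion :: "'a monoid \<Rightarrow> 'a monoid" where
  "torsion G = G\<lparr>carrier := {x \<in> carrier G. \<exists>n::nat. n > 0 \<and> x [^]\<^bsub>G\<^esub> n = \<one>\<^bsub>G\<^esub>}\<rparr>"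

lemma subgroup_torsion:
  assumes "comm_group G"
  shows "subgroup (carrier (torsion G)) G"
proof -
  interpret comm_group G by fact
  show ?thesis
  proof
    show "carrier (torsion G) \<subseteq> carrier G"
      by (auto simp: torsion_def)
    show "\<one>\<^bsub>G\<^esub> \<in> carrier (torsion G)"
      by (auto simp: torsion_def intro: exI[of _ 1])
  next
    fix x y assume "x \<in> carrier (torsion G)" "y \<in> carrier (torsion G)"
    then obtain m n :: nat where x: "x \<in> carrier G" "m > 0" "x [^]\<^bsub>G\<^esub> m = \<one>\<^bsub>G\<^esub>"
      and y: "y \<in> carrier G" "n > 0" "y [^]\<^bsub>G\<^esub> n = \<one>\<^bsub>G\<^esub>"
      by (auto simp: torsion_def)
    have "(x \<otimes>\<^bsub>G\<^esub> y) [^]\<^bsub>G\<^esub> (m * n) = (x [^]\<^bsub>G\<^esub> m) [^]\<^bsub>G\<^esub> n \<otimes>\<^bsub>G\<^esub> (y [^]\<^bsub>G\<^esub> n) [^]\<^bsub>G\<^esub> m"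
      using pow_mult_distrib[OF m_comm[OF x(1) y(1)] x(1) y(1), of "m * n"]
        nat_pow_pow[OF x(1), of m n] nat_pow_pow[OF y(1), of n m]
      by (simp add: mult.commute[of n m])
    also have "\<dots> = \<one>\<^bsub>G\<^esub>"
      using x y by simp
    finally show "x \<otimes>\<^bsub>G\<^esub> y \<in> carrier (torsion G)"
      using x y by (auto simp: torsion_def intro!: exI[of _ "m * n"])
  next
    fix x assume "x \<in> carrier (torsion G)"
    then show "inv\<^bsub>G\<^esub> x \<in> carrier (torsion G)"
      by (auto simp: torsion_def nat_pow_inv)
  qed
qed

text \<open>It is the greatest torsion subgroup, hence the unique maximal one.\<close>

lemma torsion_greatest:
  assumes "subgroup H G" and "\<And>x. x \<in> H \<Longrightarrow> \<exists>n::nat. n > 0 \<and> x [^]\<^bsub>G\<^esub> n = \<one>\<^bsub>G\<^esub>"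
  shows "H \<subseteq> carrier (torsion G)"
  using assms subgroup.subset[OF assms(1)] by (auto simp: torsion_def)


section \<open>Extensions\<close>

text \<open>
  The predicate \<open>exact_seq\<close> of HOL-Algebra requires all groups of a sequence to live on one and
  the same type, so exactness of \<open>0 \<rightarrow> A \<rightarrow> B \<rightarrow> C \<rightarrow> 0\<close> is spelled out here.
\<close>

definition short_exact ::
    "'a monoid \<Rightarrow> ('a \<Rightarrow> 'b) \<Rightarrow> 'b monoid \<Rightarrow> ('b \<Rightarrow> 'c) \<Rightarrow> 'c monoid \<Rightarrow> bool" where
  "short_exact A f B g C \<longleftrightarrow>
     f \<in> mon A B \<and> f ` carrier A = kernel B C g \<and> g \<in> epi B C"

text \<open>\<open>Extn \<phi> B \<psi>\<close> stands for \<open>0 \<rightarrow> A \<rightarrow> B \<rightarrow> C \<rightarrow> 0\<close>; the outer groups \<open>A\<close> and \<open>C\<close> are not stored.\<close>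

datatype ('a, 'b, 'c) extn =
  Extn (lmap: "'a \<Rightarrow> 'b") (mid: "'b monoid") (rmap: "'b \<Rightarrow> 'c")

definition extension :: "'a monoid \<Rightarrow> 'c monoid \<Rightarrow> ('a, 'b, 'c) extn \<Rightarrow> bool" where
  "extension A C E \<longleftrightarrow>
     comm_group A \<and> comm_group (mid E) \<and> comm_group C \<and>
     short_exact A (lmap E) (mid E) (rmap E) C"

definition t_extension :: "'a monoid \<Rightarrow> 'c monoid \<Rightarrow> ('a, 'b, 'c) extn \<Rightarrow> bool" where
  "t_extension A C E \<longleftrightarrow>
     extension A C E \<and>
     short_exact (torsion A) (lmap E) (torsion (mid E)) (rmap E) (torsion C)"

definition ext_equiv ::
    "'a monoid \<Rightarrow> 'c monoid \<Rightarrow> ('a, 'b, 'c) extn \<Rightarrow> ('a, 'x, 'c) extn \<Rightarrow> bool" where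
  "ext_equiv A C E E' \<longleftrightarrow>
     (\<exists>\<beta> \<in> iso (mid E) (mid E').
        (\<forall>a \<in> carrier A. \<beta> (lmap E a) = lmap E' a) \<and>
        (\<forall>b \<in> carrier (mid E). rmap E' (\<beta> b) = rmap E b))"


section \<open>Pushout, pullback, direct sum, Baer sum\<close>

text \<open>
  The middle group of the pushout along \<open>\<mu> : A \<rightarrow> A'\<close> is \<open>(A' \<oplus> B) / {(\<mu> a, - \<phi> a) | a \<in> A}\<close>.  Its map to
  \<open>C\<close> sends the coset of \<open>(a', b)\<close> to \<open>\<psi> b\<close>, which is constant on cosets.
\<close>

definition pushout ::
    "'a monoid \<Rightarrow> 'd monoid \<Rightarrow> ('a \<Rightarrow> 'd) \<Rightarrow> ('a, 'b, 'c) extn \<Rightarrow> ('d, ('d \<times> 'b) set, 'c) extn" where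
  "pushout A A' \<mu> E =
     (let P = A' \<times>\<times> mid E;
          N = (\<lambda>a. (\<mu> a, inv\<^bsub>mid E\<^esub> (lmap E a))) ` carrier A
      in Extn (\<lambda>a'. N #>\<^bsub>P\<^esub> (a', \<one>\<^bsub>mid E\<^esub>))
              (P Mod N)
              (\<lambda>X. the_elem ((\<lambda>(a', b). rmap E b) ` X)))"

definition pullback ::
    "'d monoid \<Rightarrow> ('d \<Rightarrow> 'c) \<Rightarrow> ('a, 'b, 'c) extn \<Rightarrow> ('a, 'b \<times> 'd, 'd) extn" where
  "pullback C' \<gamma> E =
     Extn (\<lambda>a. (lmap E a, \<one>\<^bsub>C'\<^esub>))
          ((mid E \<times>\<times> C')\<lparr>carrier :=
             {(b, c'). b \<in> carrier (mid E) \<and> c' \<in> carrier C' \<and> rmap E b = \<gamma> c'}\<rparr>)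
          snd"

definition ext_sum ::
    "('a, 'b, 'c) extn \<Rightarrow> ('d, 'e, 'f) extn \<Rightarrow> ('a \<times> 'd, 'b \<times> 'e, 'c \<times> 'f) extn" where
  "ext_sum E E' =
     Extn (map_prod (lmap E) (lmap E')) (mid E \<times>\<times> mid E') (map_prod (rmap E) (rmap E'))"

definition diagonal :: "'c \<Rightarrow> 'c \<times> 'c" where
  "diagonal c = (c, c)"

definition codiagonal :: "'a monoid \<Rightarrow> 'a \<times> 'a \<Rightarrow> 'a" where
  "codiagonal A = (\<lambda>(a, a'). a \<otimes>\<^bsub>A\<^esub> a')"

definition baer_sum ::
    "'a monoid \<Rightarrow> 'c monoid \<Rightarrow> ('a, 'b, 'c) extn \<Rightarrow> ('a, 'e, 'c) extn \<Rightarrow>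
     ('a, ('a \<times> 'b \<times> 'e) set \<times> 'c, 'c) extn" where
  "baer_sum A C E E' =
     pullback C diagonal (pushout (A \<times>\<times> A) A (codiagonal A) (ext_sum E E'))"


section \<open>The group of extensions\<close>

text \<open>
  Extensions may have middle groups on any type, and these types do not form a set.  The class
  of an extension is therefore cut down to its members with middle group on the type
  \<open>'a \<times> 'c\<close>.  Nothing is lost: every extension of \<open>A :: 'a monoid\<close> by \<open>C :: 'c monoid\<close>, on whatever
  type, is equivalent to one of this kind (\<open>ext_class_in_Ext\<close> below), and two extensions have
  the same class iff they are equivalent (\<open>ext_class_eq_iff\<close>).
\<close>

definition ext_class ::
    "'a monoid \<Rightarrow> 'c monoid \<Rightarrow> ('a, 'b, 'c) extn \<Rightarrow> ('a, 'a \<times> 'c, 'c) extn set" where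
  "ext_class A C E = {E'. extension A C E' \<and> ext_equiv A C E E'}"

definition split_extn :: "'a monoid \<Rightarrow> 'c monoid \<Rightarrow> ('a, 'a \<times> 'c, 'c) extn" where
  "split_extn A C = Extn (\<lambda>a. (a, \<one>\<^bsub>C\<^esub>)) (A \<times>\<times> C) snd"

text \<open>The sum of two classes collects the classes of the Baer sums of all representatives.\<close>

definition Ext :: "'c monoid \<Rightarrow> 'a monoid \<Rightarrow> ('a, 'a \<times> 'c, 'c) extn set monoid" where
  "Ext C A =
     \<lparr>carrier = {ext_class A C E | E :: ('a, 'a \<times> 'c, 'c) extn. extension A C E},
      mult = (\<lambda>X Y. \<Union>E\<in>X. \<Union>E'\<in>Y. ext_class A C (baer_sum A C E E')),
      one = ext_class A C (split_extn A C)\<rparr>"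

definition Ext_t :: "'c monoid \<Rightarrow> 'a monoid \<Rightarrow> ('a, 'a \<times> 'c, 'c) extn set set" where
  "Ext_t C A = {X \<in> carrier (Ext C A). \<exists>E \<in> X. t_extension A C E}"


subsection \<open>Independence of the type of the middle group\<close>

lemma ext_equiv_refl: "ext_equiv A C E E"
  unfolding ext_equiv_def by (rule bexI[of _ id]) (auto simp: iso_def hom_def)

lemma ext_equiv_sym:
  assumes "extension A C E" "ext_equiv A C E E'"
  shows "ext_equiv A C E' E"
proof -
  from assms(2) obtain \<beta> where \<beta>: "\<beta> \<in> iso (mid E) (mid E')"
    and l: "\<And>a. a \<in> carrier A \<Longrightarrow> \<beta> (lmap E a) = lmap E' a"
    and r: "\<And>b. b \<in> carrier (mid E) \<Longrightarrow> rmap E' (\<beta> b) = rmap E b"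
    by (auto simp: ext_equiv_def)
  interpret B: comm_group "mid E" using assms(1) by (simp add: extension_def)
  have inj: "inj_on \<beta> (carrier (mid E))" and im: "\<beta> ` carrier (mid E) = carrier (mid E')"
    using \<beta> by (auto simp: iso_def bij_betw_def)
  have lc: "lmap E a \<in> carrier (mid E)" if "a \<in> carrier A" for a
    using assms(1) that by (auto simp: extension_def short_exact_def mon_def hom_def)
  show ?thesis unfolding ext_equiv_def
  proof (intro bexI conjI ballI)
    show "inv_into (carrier (mid E)) \<beta> \<in> iso (mid E') (mid E)"
      using \<beta> by (rule B.iso_set_sym)
  next
    fix a assume "a \<in> carrier A"
    then show "inv_into (carrier (mid E)) \<beta> (lmap E' a) = lmap E a"
      using l lc inj by (metis inv_into_f_f)
  next
    fix b assume "b \<in> carrier (mid E')"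
    then show "rmap E (inv_into (carrier (mid E)) \<beta> b) = rmap E' b"
      using r im by (metis f_inv_into_f inv_into_into)
  qed
qed

lemma ext_equiv_trans:
  assumes "ext_equiv A C E E'" "ext_equiv A C E' E''"
  shows "ext_equiv A C E E''"
proof -
  from assms obtain \<beta> \<gamma> where
    "\<beta> \<in> iso (mid E) (mid E')" "\<gamma> \<in> iso (mid E') (mid E'')"
    "\<forall>a \<in> carrier A. \<beta> (lmap E a) = lmap E' a" "\<forall>a \<in> carrier A. \<gamma> (lmap E' a) = lmap E'' a"
    "\<forall>b \<in> carrier (mid E). rmap E' (\<beta> b) = rmap E b"
    "\<forall>b \<in> carrier (mid E'). rmap E'' (\<gamma> b) = rmap E' b"
    by (auto simp: ext_equiv_def)
  moreover from this have "\<beta> b \<in> carrier (mid E')" if "b \<in> carrier (mid E)" for b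
    using that by (auto simp: iso_def bij_betw_def)
  ultimately show ?thesis
    unfolding ext_equiv_def by (intro bexI[of _ "\<gamma> \<circ> \<beta>"]) (auto intro: iso_set_trans)
qed

text \<open>Extensions can be transported along injections of the middle group into another type.\<close>

lemma extension_transport:
  assumes E: "extension A C E" and inj: "inj_on h (carrier (mid E))"
  defines "k \<equiv> inv_into (carrier (mid E)) h"
  defines "E' \<equiv> Extn (h \<circ> lmap E) (image_group h (mid E)) (rmap E \<circ> k)"
  shows "extension A C E'" "ext_equiv A C E E'"
proof -
  let ?B = "mid E" and ?B' = "image_group h (mid E)"
  interpret B: comm_group ?B using E by (simp add: extension_def)
  have kh: "k (h b) = b" if "b \<in> carrier ?B" for b
    using inj that by (simp add: k_def)
  have car: "carrier ?B' = h ` carrier ?B" by (simp add: image_group_def)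
  have mult: "h x \<otimes>\<^bsub>?B'\<^esub> h y = h (x \<otimes>\<^bsub>?B\<^esub> y)" if "x \<in> carrier ?B" "y \<in> carrier ?B" for x y
    using that kh by (simp add: image_group_def k_def)
  have iso: "h \<in> iso ?B ?B'"
    using inj by (auto simp: iso_def hom_def bij_betw_def car mult)
  have "?B'\<lparr>one := h \<one>\<^bsub>?B\<^esub>\<rparr> = ?B'" by (simp add: image_group_def)
  then have B': "comm_group ?B'"
    using B.iso_imp_img_comm_group[OF iso] by simp
  have k: "k \<in> iso ?B' ?B"
    unfolding k_def by (rule B.iso_set_sym[OF iso])
  have ex: "lmap E \<in> mon A ?B" "lmap E ` carrier A = kernel ?B C (rmap E)" "rmap E \<in> epi ?B C"
    using E by (auto simp: extension_def short_exact_def)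
  have "h \<circ> lmap E \<in> mon A ?B'"
    using ex(1) iso mon_compose by (metis iso_iff_mon_epi)
  moreover have "rmap E \<circ> k \<in> epi ?B' C"
    using ex(3) k epi_compose by (metis iso_iff_mon_epi)
  moreover have "kernel ?B' C (rmap E \<circ> k) = h ` kernel ?B C (rmap E)"
    by (auto simp: kernel_def car kh)
  then have "(h \<circ> lmap E) ` carrier A = kernel ?B' C (rmap E \<circ> k)"
    using ex(2) by (metis image_comp)
  ultimately show "extension A C E'"
    using E B' by (auto simp: extension_def short_exact_def E'_def)
  show "ext_equiv A C E E'"
    unfolding ext_equiv_def using iso kh by (auto simp: E'_def intro!: bexI[of _ h])
qed

lemma extension_inj_exists:
  fixes E :: "('a, 'b, 'c) extn"
  assumes E: "extension A C E"
  shows "\<exists>h :: 'b \<Rightarrow> 'a \<times> 'c. inj_on h (carrier (mid E))"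
proof -
  let ?B = "mid E"
  let ?s = "\<lambda>c. SOME b. b \<in> carrier ?B \<and> rmap E b = c"
  let ?a = "\<lambda>b. inv_into (carrier A) (lmap E) (b \<otimes>\<^bsub>?B\<^esub> inv\<^bsub>?B\<^esub> (?s (rmap E b)))"
  interpret B: comm_group ?B using E by (simp add: extension_def)
  interpret C: comm_group C using E by (simp add: extension_def)
  have ex: "lmap E \<in> mon A ?B" "lmap E ` carrier A = kernel ?B C (rmap E)" "rmap E \<in> epi ?B C"
    using E by (auto simp: extension_def short_exact_def)
  have "rmap E \<in> hom ?B C" using ex(3) by (simp add: epi_def)
  then interpret r: group_hom ?B C "rmap E"
    by (simp add: group_hom_def group_hom_axioms_def B.is_group C.is_group)
  have s: "?s (rmap E b) \<in> carrier ?B \<and> rmap E (?s (rmap E b)) = rmap E b"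
    if "b \<in> carrier ?B" for b
    by (rule someI[where P = "\<lambda>x. x \<in> carrier ?B \<and> rmap E x = rmap E b"]) (use that in simp)
  have rec: "lmap E (?a b) \<otimes>\<^bsub>?B\<^esub> ?s (rmap E b) = b" if b: "b \<in> carrier ?B" for b
  proof -
    have "b \<otimes>\<^bsub>?B\<^esub> inv\<^bsub>?B\<^esub> (?s (rmap E b)) \<in> kernel ?B C (rmap E)"
      using s[OF b] b by (simp add: kernel_def)
    then have "lmap E (?a b) = b \<otimes>\<^bsub>?B\<^esub> inv\<^bsub>?B\<^esub> (?s (rmap E b))"
      using ex(2) by (intro f_inv_into_f) simp
    then show ?thesis using s[OF b] b by (simp add: B.m_assoc)
  qed
  define h where "h = (\<lambda>b. (?a b, rmap E b))"
  have "inj_on h (carrier ?B)"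
  proof (rule inj_onI)
    fix x y assume xy: "x \<in> carrier ?B" "y \<in> carrier ?B" "h x = h y"
    then have "(?a x, rmap E x) = (?a y, rmap E y)" by (simp only: h_def)
    then have 1: "?a x = ?a y" and 2: "rmap E x = rmap E y" by (blast dest: Pair_inject)+
    have "x = lmap E (?a x) \<otimes>\<^bsub>?B\<^esub> ?s (rmap E x)" using rec[OF xy(1)] by (rule sym)
    also have "\<dots> = lmap E (?a y) \<otimes>\<^bsub>?B\<^esub> ?s (rmap E y)" unfolding 1 unfolding 2 by (rule refl)
    also have "\<dots> = y" by (rule rec[OF xy(2)])
    finally show "x = y" .
  qed
  then show ?thesis by (intro exI[of _ h])
qed

lemma ext_class_nonempty:
  fixes E :: "('a, 'b, 'c) extn"
  assumes "extension A C E"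
  obtains F where "extension A C F" "ext_equiv A C E F" "F \<in> ext_class A C E"
proof -
  from extension_inj_exists[OF assms] obtain h where
    h: "inj_on (h :: 'b \<Rightarrow> 'a \<times> 'c) (carrier (mid E))" by (elim exE)
  from extension_transport[OF assms h] show ?thesis
    by (intro that) (auto simp: ext_class_def)
qed

lemma ext_class_eq_iff:
  assumes "extension A C E" "extension A C E'"
  shows "ext_class A C E = ext_class A C E' \<longleftrightarrow> ext_equiv A C E E'"
proof
  assume eq: "ext_class A C E = ext_class A C E'"
  obtain F where "F \<in> ext_class A C E"
    using assms(1) by (rule ext_class_nonempty)
  then have "ext_equiv A C E F" "ext_equiv A C E' F"
    using eq by (auto simp: ext_class_def)
  then show "ext_equiv A C E E'"
    using ext_equiv_trans ext_equiv_sym[OF assms(2)] by blast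
next
  assume E: "ext_equiv A C E E'"
  show "ext_class A C E = ext_class A C E'"
    using ext_equiv_trans[OF E] ext_equiv_trans[OF ext_equiv_sym[OF assms(1) E]]
    by (auto simp: ext_class_def)
qed

lemma ext_class_in_Ext:
  assumes "extension A C E"
  shows "ext_class A C E \<in> carrier (Ext C A)"
proof -
  obtain F where F: "extension A C F" "ext_equiv A C E F" "F \<in> ext_class A C E"
    using assms by (rule ext_class_nonempty)
  then have "ext_class A C E = ext_class A C F"
    using ext_class_eq_iff[OF assms F(1)] by simp
  with F(1) show ?thesis by (auto simp: Ext_def)
qed

end

theory Submission
  imports Defs
begin

text \<open>
  Up to equivalence, Baer sums can be described without cosets.  Let \<open>B\<^sub>1 \<times>\<^sub>C B\<^sub>2\<close> be the
  group of pairs with equal image in \<open>C\<close>.  An extension \<open>E\<^sub>3\<close> is equivalent to the Baer sum of \<open>E\<^sub>1\<close> and \<open>E\<^sub>2\<close> as soon as there is a homomorphism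
  \<open>B\<^sub>1 \<times>\<^sub>C B\<^sub>2 \<rightarrow> B\<^sub>3\<close> over \<open>C\<close> that is the addition \<open>A \<oplus> A \<rightarrow> A\<close> on the kernels; this relation is
  \<open>is_baer_sum\<close>.  The cosets matter only for \<open>is_baer_sum_baer_sum\<close>, which says that the Baer
  sum itself has such a homomorphism.  Uniqueness (\<open>is_baer_sum_unique\<close>) holds because
  any such homomorphism is onto with kernel \<open>{(\<phi>\<^sub>1 a, \<phi>\<^sub>2 (-a))}\<close>, so \<open>B\<^sub>3\<close> is determined as a
  quotient of \<open>B\<^sub>1 \<times>\<^sub>C B\<^sub>2\<close>.

  Each group law now amounts to writing down homomorphisms.  The split extension is neutral by
  \<open>((a, c), b) \<mapsto> \<phi> a + b\<close>.  Replacing \<open>\<phi>\<close> by \<open>-\<phi>\<close> gives the inverse, since \<open>b' - b\<close> lies in the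
  image of \<open>A\<close> whenever \<open>b\<close> and \<open>b'\<close> have the same image in \<open>C\<close>.  For associativity both
  bracketings are quotients of \<open>B\<^sub>1 \<times>\<^sub>C B\<^sub>2 \<times>\<^sub>C B\<^sub>3\<close> by the same subgroup.

  For the t-extensions, the sequence of torsion subgroups of any extension is exact except
  perhaps at \<open>tC\<close>, so \<open>E\<close> is a t-extension iff every torsion element of \<open>C\<close> lifts to a torsion
  element of \<open>B\<close> (\<open>t_extension_iff\<close>).  Lifts \<open>b\<^sub>1\<close> and \<open>b\<^sub>2\<close> of the same \<open>c\<close> form a torsion element of
  \<open>B\<^sub>1 \<times>\<^sub>C B\<^sub>2\<close>, whose image in the Baer sum is a torsion lift of \<open>c\<close>.  Negation changes neither
  \<open>B\<close> nor its map to \<open>C\<close>, and in the split extension \<open>(0, c)\<close> lifts \<open>c\<close>.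
\<close>

section \<open>Extensions elementwise\<close>

lemma extension_iff:
  "extension A C E \<longleftrightarrow>
     comm_group A \<and> comm_group (mid E) \<and> comm_group C \<and>
     lmap E \<in> hom A (mid E) \<and> rmap E \<in> hom (mid E) C \<and>
     (\<forall>a\<in>carrier A. lmap E a = \<one>\<^bsub>mid E\<^esub> \<longrightarrow> a = \<one>\<^bsub>A\<^esub>) \<and>
     (\<forall>a\<in>carrier A. rmap E (lmap E a) = \<one>\<^bsub>C\<^esub>) \<and>
     (\<forall>b\<in>carrier (mid E). rmap E b = \<one>\<^bsub>C\<^esub> \<longrightarrow> (\<exists>a\<in>carrier A. lmap E a = b)) \<and>
     (\<forall>c\<in>carrier C. \<exists>b\<in>carrier (mid E). rmap E b = c)"
  (is "?L \<longleftrightarrow> ?R")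
proof
  assume L: ?L
  then have "kernel (mid E) C (rmap E) = lmap E ` carrier A" "rmap E ` carrier (mid E) = carrier C"
    by (auto simp: extension_def short_exact_def epi_def)
  then have "\<forall>a\<in>carrier A. rmap E (lmap E a) = \<one>\<^bsub>C\<^esub>"
    "\<forall>b\<in>carrier (mid E). rmap E b = \<one>\<^bsub>C\<^esub> \<longrightarrow> (\<exists>a\<in>carrier A. lmap E a = b)"
    "\<forall>c\<in>carrier C. \<exists>b\<in>carrier (mid E). rmap E b = c"
    by (auto simp: kernel_def set_eq_iff image_iff) metis+
  with L show ?R
    by (auto simp: extension_def short_exact_def mon_iff_hom_one comm_group_def epi_def)
next
  assume R: ?R
  then have "lmap E a \<in> carrier (mid E)" if "a \<in> carrier A" for a
    using that by (auto simp: hom_def)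
  with R have "lmap E ` carrier A = kernel (mid E) C (rmap E)"
    by (auto simp: kernel_def)
  moreover have "rmap E b \<in> carrier C" if "b \<in> carrier (mid E)" for b
    using R that by (auto simp: hom_def)
  with R have "rmap E ` carrier (mid E) = carrier C"
    by auto
  ultimately show ?L using R
    by (simp add: extension_def short_exact_def mon_iff_hom_one comm_group_def epi_def)
qed

locale group_extension =
  fixes A :: "'a monoid" and C :: "'c monoid" and E :: "('a, 'b, 'c) extn"
  assumes ext: "extension A C E"
begin

sublocale A: comm_group A using ext by (simp add: extension_iff)
sublocale B: comm_group "mid E" using ext by (simp add: extension_iff)
sublocale C: comm_group C using ext by (simp add: extension_iff)
sublocale l: group_hom A "mid E" "lmap E"
  using ext by unfold_locales (simp add: extension_iff)
sublocale r: group_hom "mid E" C "rmap E"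
  using ext by unfold_locales (simp add: extension_iff)

lemma l_eq_one: "a \<in> carrier A \<Longrightarrow> lmap E a = \<one>\<^bsub>mid E\<^esub> \<longleftrightarrow> a = \<one>\<^bsub>A\<^esub>"
  using ext by (auto simp: extension_iff)

lemma r_l [simp]: "a \<in> carrier A \<Longrightarrow> rmap E (lmap E a) = \<one>\<^bsub>C\<^esub>"
  using ext by (simp add: extension_iff)

lemma ker_r:
  assumes "b \<in> carrier (mid E)" "rmap E b = \<one>\<^bsub>C\<^esub>"
  obtains a where "a \<in> carrier A" "lmap E a = b"
  using ext assms by (auto simp: extension_iff)

lemma r_surj:
  assumes "c \<in> carrier C"
  obtains b where "b \<in> carrier (mid E)" "rmap E b = c"
  using ext assms by (auto simp: extension_iff)

lemma same_image:
  assumes "b \<in> carrier (mid E)" "b' \<in> carrier (mid E)" "rmap E b = rmap E b'"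
  obtains a where "a \<in> carrier A" "b = lmap E a \<otimes>\<^bsub>mid E\<^esub> b'"
proof -
  have "rmap E (b \<otimes>\<^bsub>mid E\<^esub> inv\<^bsub>mid E\<^esub> b') = \<one>\<^bsub>C\<^esub>"
    using assms by simp
  then obtain a where a: "a \<in> carrier A" "lmap E a = b \<otimes>\<^bsub>mid E\<^esub> inv\<^bsub>mid E\<^esub> b'"
    using assms by (meson B.inv_closed B.m_closed ker_r)
  show thesis
    by (rule that[OF a(1)]) (simp add: a(2) assms B.m_assoc)
qed

end


section \<open>The constructions yield extensions\<close>

lemma comm_group_DirProd:
  assumes "comm_group G" "comm_group H"
  shows "comm_group (G \<times>\<times> H)"
proof -
  interpret G: comm_group G by fact
  interpret H: comm_group H by fact
  show ?thesis
    by (rule group.group_comm_groupI)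
      (auto intro: DirProd_group simp: G.m_comm H.m_comm)
qed

lemma comm_group_subgroup:
  assumes "comm_group G" "subgroup H G"
  shows "comm_group (G\<lparr>carrier := H\<rparr>)"
proof -
  interpret G: comm_group G by fact
  show ?thesis
    by (rule group.group_comm_groupI)
      (use subgroup.subset[OF assms(2)] in \<open>auto intro: G.subgroup_imp_group assms G.m_comm\<close>)
qed

lemma extension_ext_sum:
  assumes "extension A C E" "extension A' C' E'"
  shows "extension (A \<times>\<times> A') (C \<times>\<times> C') (ext_sum E E')"
proof -
  interpret E: group_extension A C E using assms(1) by unfold_locales
  interpret E': group_extension A' C' E' using assms(2) by unfold_locales
  have "map_prod (lmap E) (lmap E') \<in> hom (A \<times>\<times> A') (mid E \<times>\<times> mid E')"
    "map_prod (rmap E) (rmap E') \<in> hom (mid E \<times>\<times> mid E') (C \<times>\<times> C')"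
    by (auto simp: hom_def)
  then show ?thesis
    unfolding extension_iff
    by (auto simp: ext_sum_def comm_group_DirProd E.A.comm_group_axioms E.B.comm_group_axioms
        E.C.comm_group_axioms E'.A.comm_group_axioms E'.B.comm_group_axioms
        E'.C.comm_group_axioms E.l_eq_one E'.l_eq_one)
      (metis E.ker_r E'.ker_r E.r_surj E'.r_surj SigmaI map_prod_simp)+
qed

definition fibre_product ::
    "'b monoid \<Rightarrow> ('b \<Rightarrow> 'c) \<Rightarrow> 'd monoid \<Rightarrow> ('d \<Rightarrow> 'c) \<Rightarrow> ('b \<times> 'd) monoid" where
  "fibre_product B f D g =
     (B \<times>\<times> D)\<lparr>carrier := {(b, d). b \<in> carrier B \<and> d \<in> carrier D \<and> f b = g d}\<rparr>"

lemma fibre_product_simps [simp]: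
  "(b, d) \<in> carrier (fibre_product B f D g) \<longleftrightarrow> b \<in> carrier B \<and> d \<in> carrier D \<and> f b = g d"
  "\<one>\<^bsub>fibre_product B f D g\<^esub> = (\<one>\<^bsub>B\<^esub>, \<one>\<^bsub>D\<^esub>)"
  "(b, d) \<otimes>\<^bsub>fibre_product B f D g\<^esub> (b', d') = (b \<otimes>\<^bsub>B\<^esub> b', d \<otimes>\<^bsub>D\<^esub> d')"
  by (simp_all add: fibre_product_def)

lemma fibre_product_comm_group:
  assumes "comm_group B" "comm_group D" "comm_group C" "f \<in> hom B C" "g \<in> hom D C"
  shows "comm_group (fibre_product B f D g)"
proof -
  interpret B: comm_group B by fact
  interpret D: comm_group D by fact
  interpret C: comm_group C by fact
  interpret f: group_hom B C f using assms by unfold_locales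
  interpret g: group_hom D C g using assms by unfold_locales
  interpret BD: comm_group "B \<times>\<times> D" by (intro comm_group_DirProd assms)
  have "subgroup {(b, d). b \<in> carrier B \<and> d \<in> carrier D \<and> f b = g d} (B \<times>\<times> D)"
    by unfold_locales (auto simp: B.group_axioms D.group_axioms)
  then show ?thesis unfolding fibre_product_def
    by (intro comm_group_subgroup BD.comm_group_axioms)
qed

lemma fibre_product_hom:
  "fst \<in> hom (fibre_product B f D g) B" "snd \<in> hom (fibre_product B f D g) D"
  by (auto simp: hom_def)

lemma pullback_simps [simp]:
  "lmap (pullback C' \<gamma> E) = (\<lambda>a. (lmap E a, \<one>\<^bsub>C'\<^esub>))"
  "mid (pullback C' \<gamma> E) = fibre_product (mid E) (rmap E) C' \<gamma>"
  "rmap (pullback C' \<gamma> E) = snd"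
  by (simp_all add: pullback_def fibre_product_def)

lemma extension_pullback:
  assumes E: "extension A C E" and C': "comm_group C'" and \<gamma>: "\<gamma> \<in> hom C' C"
  shows "extension A C' (pullback C' \<gamma> E)"
proof -
  interpret group_extension A C E using E by unfold_locales
  interpret C': comm_group C' by fact
  interpret \<gamma>: group_hom C' C \<gamma> using \<gamma> by unfold_locales
  have "comm_group (fibre_product (mid E) (rmap E) C' \<gamma>)"
    by (intro fibre_product_comm_group[where C = C] C' \<gamma> B.comm_group_axioms C.comm_group_axioms
        r.homh)
  moreover have "\<exists>a\<in>carrier A. (lmap E a, \<one>\<^bsub>C'\<^esub>) = (b, \<one>\<^bsub>C'\<^esub>)"
    if "b \<in> carrier (mid E)" "rmap E b = \<gamma> \<one>\<^bsub>C'\<^esub>" for b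
    using that by (auto elim!: ker_r)
  moreover have "\<exists>x\<in>carrier (fibre_product (mid E) (rmap E) C' \<gamma>). snd x = c'"
    if c': "c' \<in> carrier C'" for c'
  proof -
    obtain b where "b \<in> carrier (mid E)" "rmap E b = \<gamma> c'"
      using r_surj[OF \<gamma>.hom_closed[OF c']] .
    then show ?thesis using c' by (intro bexI[of _ "(b, c')"]) auto
  qed
  ultimately show ?thesis
    unfolding extension_iff
    by (auto simp: fibre_product_hom l_eq_one A.comm_group_axioms C' hom_def)
qed

text \<open>
  The pushout comes with a homomorphism from the old middle group that extends \<open>\<mu>\<close> and induces
  the identity on \<open>C\<close>.  Besides exactness, this map is all that Baer sums need to know about the cosets.
\<close>

lemma (in group_extension)
  assumes A': "comm_group A'" and \<mu>: "\<mu> \<in> hom A A'"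
  shows extension_pushout: "extension A' C (pushout A A' \<mu> E)"
    and pushout_map: "\<exists>k \<in> hom (mid E) (mid (pushout A A' \<mu> E)).
      (\<forall>a\<in>carrier A. k (lmap E a) = lmap (pushout A A' \<mu> E) (\<mu> a)) \<and>
      (\<forall>b\<in>carrier (mid E). rmap (pushout A A' \<mu> E) (k b) = rmap E b)"
proof -
  interpret A': comm_group A' by (rule A')
  interpret \<mu>: group_hom A A' \<mu> using \<mu> by unfold_locales
  define P where "P = A' \<times>\<times> mid E"
  interpret P: comm_group P
    unfolding P_def by (intro comm_group_DirProd A' B.comm_group_axioms)
  define N where "N = (\<lambda>a. (\<mu> a, inv\<^bsub>mid E\<^esub> (lmap E a))) ` carrier A"
  have "(\<lambda>a. (\<mu> a, inv\<^bsub>mid E\<^esub> (lmap E a))) \<in> hom A P"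
    by (auto simp: hom_def B.inv_mult P_def)
  then interpret n: group_hom A P "\<lambda>a. (\<mu> a, inv\<^bsub>mid E\<^esub> (lmap E a))"
    by unfold_locales
  have N: "subgroup N P"
    unfolding N_def by (rule n.img_is_subgroup)
  interpret N: normal N P
    by (rule P.subgroup_imp_normal[OF N])
  \<comment> \<open>All computations in the quotient go through representatives: \<open>c a' b\<close> is the class of \<open>(a', b)\<close>.\<close>
  define c where "c = (\<lambda>a' b. N #>\<^bsub>P\<^esub> (a', b))"
  have c_elems: "c a' b = {(\<mu> a \<otimes>\<^bsub>A'\<^esub> a', inv\<^bsub>mid E\<^esub> (lmap E a) \<otimes>\<^bsub>mid E\<^esub> b) | a. a \<in> carrier A}" for a' b
    by (auto simp: c_def r_coset_def N_def P_def)
  have c_eq: "c a' b = c a'' b' \<longleftrightarrow>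
      (\<exists>a\<in>carrier A. a' = \<mu> a \<otimes>\<^bsub>A'\<^esub> a'' \<and> b = inv\<^bsub>mid E\<^esub> (lmap E a) \<otimes>\<^bsub>mid E\<^esub> b')"
    if "a' \<in> carrier A'" "b \<in> carrier (mid E)" "a'' \<in> carrier A'" "b' \<in> carrier (mid E)" for a' b a'' b'
  proof -
    have "c a' b = c a'' b' \<longleftrightarrow> (a', b) \<in> c a'' b'"
      using that P.repr_independence[OF _ _ N, of "(a', b)" "(a'', b')"]
        P.rcos_self[OF _ N, of "(a', b)"]
      by (auto simp: c_def P_def)
    then show ?thesis by (auto simp: c_elems)
  qed
  have c_mult: "c a' b <#>\<^bsub>P\<^esub> c a'' b' = c (a' \<otimes>\<^bsub>A'\<^esub> a'') (b \<otimes>\<^bsub>mid E\<^esub> b')"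
    if "a' \<in> carrier A'" "b \<in> carrier (mid E)" "a'' \<in> carrier A'" "b' \<in> carrier (mid E)" for a' b a'' b'
    using that N.rcos_sum[of "(a', b)" "(a'', b')"] by (simp add: c_def P_def)
  have c_carrier: "X \<in> carrier (P Mod N) \<longleftrightarrow>
      (\<exists>a'\<in>carrier A'. \<exists>b\<in>carrier (mid E). X = c a' b)" for X
    by (auto simp: carrier_FactGroup c_def P_def)
  have c_r: "the_elem ((\<lambda>(a', b). rmap E b) ` c a' b) = rmap E b"
    if "b \<in> carrier (mid E)" for a' b
  proof -
    have "(\<lambda>(a', b). rmap E b) ` c a' b = {rmap E b}"
      using that by (force simp: c_elems)
    then show ?thesis by simp
  qed
  have c_ker: "c a' (lmap E a) = c (\<mu> a \<otimes>\<^bsub>A'\<^esub> a') \<one>\<^bsub>mid E\<^esub>"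
    if "a' \<in> carrier A'" "a \<in> carrier A" for a a'
    using that
    by (subst c_eq) (auto intro!: bexI[of _ "inv\<^bsub>A\<^esub> a"] simp: A'.m_assoc[symmetric])
  have po: "pushout A A' \<mu> E =
      Extn (\<lambda>a'. c a' \<one>\<^bsub>mid E\<^esub>) (P Mod N) (\<lambda>X. the_elem ((\<lambda>(a', b). rmap E b) ` X))"
    by (simp add: pushout_def Let_def P_def N_def c_def)
  have "comm_group (P Mod N)"
    by (rule P.abelian_FactGroup[OF N])
  moreover have "c a' b \<in> carrier (P Mod N)" if "a' \<in> carrier A'" "b \<in> carrier (mid E)" for a' b
    using that by (auto simp: c_carrier)
  then have hom_A': "(\<lambda>a'. c a' \<one>\<^bsub>mid E\<^esub>) \<in> hom A' (P Mod N)"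
    and hom_B: "c \<one>\<^bsub>A'\<^esub> \<in> hom (mid E) (P Mod N)"
    by (auto simp: hom_def c_mult)
  moreover have "(\<lambda>X. the_elem ((\<lambda>(a', b). rmap E b) ` X)) \<in> hom (P Mod N) C"
    by (auto simp: hom_def c_carrier c_mult c_r)
  moreover have N_one: "N = c \<one>\<^bsub>A'\<^esub> \<one>\<^bsub>mid E\<^esub>"
    using P.coset_mult_one[OF N.subset] by (simp add: c_def P_def)
  moreover have "a' = \<one>\<^bsub>A'\<^esub>" if a': "a' \<in> carrier A'" "c a' \<one>\<^bsub>mid E\<^esub> = N" for a'
  proof -
    have "c a' \<one>\<^bsub>mid E\<^esub> = c \<one>\<^bsub>A'\<^esub> \<one>\<^bsub>mid E\<^esub>"
      using a'(2) N_one by simp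
    then obtain a where a: "a \<in> carrier A" "a' = \<mu> a" "\<one>\<^bsub>mid E\<^esub> = inv\<^bsub>mid E\<^esub> (lmap E a)"
      using a'(1) by (auto simp: c_eq simp del: l.hom_inv)
    then have "lmap E a = \<one>\<^bsub>mid E\<^esub>"
      by (metis B.inv_inv B.inv_one l.hom_closed)
    with a show ?thesis
      by (simp add: l_eq_one)
  qed
  moreover have "\<exists>a''\<in>carrier A'. c a'' \<one>\<^bsub>mid E\<^esub> = X"
    if X_ker: "X \<in> carrier (P Mod N)" "the_elem ((\<lambda>(a', b). rmap E b) ` X) = \<one>\<^bsub>C\<^esub>" for X
  proof -
    obtain a' b where a': "a' \<in> carrier A'" and b: "b \<in> carrier (mid E)" "rmap E b = \<one>\<^bsub>C\<^esub>"
      and X: "X = c a' b"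
      using X_ker c_r by (auto simp: c_carrier)
    obtain a where "a \<in> carrier A" "lmap E a = b"
      using ker_r[OF b] .
    then show ?thesis using a' X c_ker by (intro bexI[of _ "\<mu> a \<otimes>\<^bsub>A'\<^esub> a'"]) auto
  qed
  moreover have "\<exists>X\<in>carrier (P Mod N). the_elem ((\<lambda>(a', b). rmap E b) ` X) = x"
    if x: "x \<in> carrier C" for x
  proof -
    obtain b where "b \<in> carrier (mid E)" "rmap E b = x"
      using r_surj[OF x] .
    then show ?thesis
      by (intro bexI[of _ "c \<one>\<^bsub>A'\<^esub> b"]) (auto simp: c_r c_carrier)
  qed
  ultimately show "extension A' C (pushout A A' \<mu> E)"
    unfolding extension_iff po using hom_A'
    by (auto simp: A' C.comm_group_axioms c_carrier c_r)
  show "\<exists>k \<in> hom (mid E) (mid (pushout A A' \<mu> E)).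
      (\<forall>a\<in>carrier A. k (lmap E a) = lmap (pushout A A' \<mu> E) (\<mu> a)) \<and>
      (\<forall>b\<in>carrier (mid E). rmap (pushout A A' \<mu> E) (k b) = rmap E b)"
    unfolding po by (rule bexI[of _ "c \<one>\<^bsub>A'\<^esub>"]) (auto simp: hom_B c_r c_ker)
qed


section \<open>Comparing extensions\<close>

text \<open>
  The short five lemma: the inverse required in an equivalence comes for free.
\<close>

lemma ext_equivI:
  assumes "extension A C E" "extension A C E'" and \<beta>: "\<beta> \<in> hom (mid E) (mid E')"
    and l: "\<And>a. a \<in> carrier A \<Longrightarrow> \<beta> (lmap E a) = lmap E' a"
    and r: "\<And>b. b \<in> carrier (mid E) \<Longrightarrow> rmap E' (\<beta> b) = rmap E b"
  shows "ext_equiv A C E E'"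
proof -
  interpret E: group_extension A C E using assms(1) by unfold_locales
  interpret E': group_extension A C E' using assms(2) by unfold_locales
  interpret \<beta>: group_hom "mid E" "mid E'" \<beta> using \<beta> by unfold_locales
  have "\<beta> \<in> iso (mid E) (mid E')"
    unfolding \<beta>.iso_iff
  proof (intro conjI subsetI ballI impI)
    fix b' assume b': "b' \<in> carrier (mid E')"
    obtain b where b: "b \<in> carrier (mid E)" "rmap E b = rmap E' b'"
      using E.r_surj[OF E'.r.hom_closed[OF b']] .
    then obtain a where a: "a \<in> carrier A" "b' = lmap E' a \<otimes>\<^bsub>mid E'\<^esub> \<beta> b"
      using E'.same_image[OF b' \<beta>.hom_closed[OF b(1)]] r by metis
    then show "b' \<in> \<beta> ` carrier (mid E)"
      using b l by (intro image_eqI[of _ _ "lmap E a \<otimes>\<^bsub>mid E\<^esub> b"]) auto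
  next
    fix b assume b: "b \<in> carrier (mid E)" "\<beta> b = \<one>\<^bsub>mid E'\<^esub>"
    then have "rmap E b = \<one>\<^bsub>C\<^esub>"
      using r[OF b(1)] by simp
    then obtain a where a: "a \<in> carrier A" "lmap E a = b"
      using E.ker_r b(1) by metis
    then have "lmap E' a = \<one>\<^bsub>mid E'\<^esub>"
      using l b(2) by metis
    then show "b = \<one>\<^bsub>mid E\<^esub>"
      using a by (auto simp: E'.l_eq_one)
  qed
  then show ?thesis
    unfolding ext_equiv_def using l r by blast
qed

text \<open>
  The hypotheses force \<open>h\<close> to be onto (\<open>onto_C\<close> reaches every coset of \<open>A\<close>, \<open>onto_A\<close> moves within
  it), and its kernel is sent to \<open>0\<close> by \<open>h'\<close>: if \<open>h p = 0\<close>, then \<open>h p\<close> and \<open>h' p\<close> come from the same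
  \<open>a\<close>, and \<open>a = 0\<close> as \<open>A\<close> embeds.  Hence \<open>h'\<close> factors through \<open>h\<close>, and the short five lemma applies.
  Two comparisons use this: any two Baer sums of the same extensions, and the
  two bracketings of a triple sum.
\<close>

lemma common_cover_imp_ext_equiv:
  assumes "extension A C E" "extension A C E'" and P: "group P"
    and "h \<in> hom P (mid E)" "h' \<in> hom P (mid E')"
    and over_C: "\<And>p. p \<in> carrier P \<Longrightarrow> rmap E (h p) = rmap E' (h' p)"
    and onto_C: "\<And>c. c \<in> carrier C \<Longrightarrow> \<exists>p\<in>carrier P. rmap E (h p) = c"
    and kernel: "\<And>p. p \<in> carrier P \<Longrightarrow> rmap E (h p) = \<one>\<^bsub>C\<^esub> \<Longrightarrow>
      \<exists>a\<in>carrier A. h p = lmap E a \<and> h' p = lmap E' a"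
    and onto_A: "\<And>a. a \<in> carrier A \<Longrightarrow> \<exists>p\<in>carrier P. h p = lmap E a \<and> h' p = lmap E' a"
  shows "ext_equiv A C E E'"
proof -
  interpret E: group_extension A C E using assms(1) by unfold_locales
  interpret E': group_extension A C E' using assms(2) by unfold_locales
  interpret P: group P by fact
  interpret h: group_hom P "mid E" h using assms by unfold_locales
  interpret h': group_hom P "mid E'" h' using assms by unfold_locales
  have surj: "\<exists>p\<in>carrier P. h p = b" if b: "b \<in> carrier (mid E)" for b
  proof -
    obtain p where p: "p \<in> carrier P" "rmap E (h p) = rmap E b"
      using onto_C[OF E.r.hom_closed[OF b]] by auto
    then obtain a where a: "a \<in> carrier A" "b = lmap E a \<otimes>\<^bsub>mid E\<^esub> h p"
      using E.same_image[OF b h.hom_closed[OF p(1)]] by metis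
    then obtain q where "q \<in> carrier P" "h q = lmap E a"
      using onto_A by metis
    then show ?thesis using p a by (intro bexI[of _ "q \<otimes>\<^bsub>P\<^esub> p"]) auto
  qed
  have wd: "h' p = h' q" if p: "p \<in> carrier P" and q: "q \<in> carrier P" and eq: "h p = h q" for p q
  proof -
    let ?x = "p \<otimes>\<^bsub>P\<^esub> inv\<^bsub>P\<^esub> q"
    have x: "?x \<in> carrier P" "h ?x = \<one>\<^bsub>mid E\<^esub>"
      using p q eq by auto
    then obtain a where a: "a \<in> carrier A" "h ?x = lmap E a" "h' ?x = lmap E' a"
      using kernel[of ?x] by auto
    then have "a = \<one>\<^bsub>A\<^esub>"
      using x E.l_eq_one by metis
    with a have "h' ?x = \<one>\<^bsub>mid E'\<^esub>"
      by simp
    moreover have "h' p = h' (?x \<otimes>\<^bsub>P\<^esub> q)"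
      using p q by (simp add: P.m_assoc)
    ultimately show ?thesis
      using x(1) q by (simp del: h'.hom_inv)
  qed
  \<comment> \<open>The factorization of \<open>h'\<close> through \<open>h\<close>; by \<open>wd\<close> the choice of the preimage is irrelevant.\<close>
  define \<beta> where "\<beta> = (\<lambda>b. h' (SOME p. p \<in> carrier P \<and> h p = b))"
  have \<beta>: "\<beta> (h p) = h' p" if "p \<in> carrier P" for p
    unfolding \<beta>_def
    using someI[of "\<lambda>q. q \<in> carrier P \<and> h q = h p" p] that by (intro wd) auto
  show ?thesis
  proof (rule ext_equivI[of _ _ _ _ \<beta>])
    show "\<beta> \<in> hom (mid E) (mid E')"
    proof (rule homI)
      fix x assume "x \<in> carrier (mid E)"
      then show "\<beta> x \<in> carrier (mid E')" using surj \<beta> h'.hom_closed by metis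
    next
      fix x y assume "x \<in> carrier (mid E)" "y \<in> carrier (mid E)"
      then obtain p q where "p \<in> carrier P" "q \<in> carrier P" "x = h p" "y = h q"
        using surj by metis
      then show "\<beta> (x \<otimes>\<^bsub>mid E\<^esub> y) = \<beta> x \<otimes>\<^bsub>mid E'\<^esub> \<beta> y"
        using \<beta>[of "p \<otimes>\<^bsub>P\<^esub> q"] \<beta> by simp
    qed
  next
    fix a assume "a \<in> carrier A"
    then show "\<beta> (lmap E a) = lmap E' a" using onto_A \<beta> by metis
  next
    fix b assume "b \<in> carrier (mid E)"
    then show "rmap E' (\<beta> b) = rmap E b" using surj \<beta> over_C by metis
  qed (fact assms)+
qed


section \<open>Recognizing Baer sums\<close>

text \<open>
  The Baer sum up to equivalence.  The map \<open>h\<close> represents the projection of the fibre product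
  to its quotient by the antidiagonal copy of \<open>A\<close>, which is the usual description of the middle
  group.  The middle groups may have different types, so that sums of sums need no transport.
\<close>

definition is_baer_sum ::
    "'a monoid \<Rightarrow> ('a, 'b, 'c) extn \<Rightarrow> ('a, 'd, 'c) extn \<Rightarrow> ('a, 'e, 'c) extn \<Rightarrow> bool" where
  "is_baer_sum A E\<^sub>1 E\<^sub>2 E\<^sub>3 \<longleftrightarrow>
     (\<exists>h \<in> hom (fibre_product (mid E\<^sub>1) (rmap E\<^sub>1) (mid E\<^sub>2) (rmap E\<^sub>2)) (mid E\<^sub>3).
        (\<forall>a\<in>carrier A. \<forall>a'\<in>carrier A. h (lmap E\<^sub>1 a, lmap E\<^sub>2 a') = lmap E\<^sub>3 (a \<otimes>\<^bsub>A\<^esub> a')) \<and>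
        (\<forall>b\<in>carrier (mid E\<^sub>1). \<forall>b'\<in>carrier (mid E\<^sub>2).
           rmap E\<^sub>1 b = rmap E\<^sub>2 b' \<longrightarrow> rmap E\<^sub>3 (h (b, b')) = rmap E\<^sub>1 b))"

lemma is_baer_sumE:
  assumes "is_baer_sum A E\<^sub>1 E\<^sub>2 E\<^sub>3"
  obtains h where "h \<in> hom (fibre_product (mid E\<^sub>1) (rmap E\<^sub>1) (mid E\<^sub>2) (rmap E\<^sub>2)) (mid E\<^sub>3)"
    "\<And>a a'. a \<in> carrier A \<Longrightarrow> a' \<in> carrier A \<Longrightarrow> h (lmap E\<^sub>1 a, lmap E\<^sub>2 a') = lmap E\<^sub>3 (a \<otimes>\<^bsub>A\<^esub> a')"
    "\<And>b b'. b \<in> carrier (mid E\<^sub>1) \<Longrightarrow> b' \<in> carrier (mid E\<^sub>2) \<Longrightarrow> rmap E\<^sub>1 b = rmap E\<^sub>2 b' \<Longrightarrow>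
      rmap E\<^sub>3 (h (b, b')) = rmap E\<^sub>1 b"
  using assms unfolding is_baer_sum_def by auto

lemma comm_group_fibre_product_extensions:
  assumes "extension A C E\<^sub>1" "extension A C E\<^sub>2"
  shows "comm_group (fibre_product (mid E\<^sub>1) (rmap E\<^sub>1) (mid E\<^sub>2) (rmap E\<^sub>2))"
  using assms by (intro fibre_product_comm_group[where C = C]) (auto simp: extension_iff)

text \<open>
  Both candidates are covered by the fibre product.  A pair over \<open>0\<close> has the form
  \<open>(\<phi>\<^sub>1 a, \<phi>\<^sub>2 a')\<close> and is sent to the image of \<open>a + a'\<close> in either of them.
\<close>

lemma is_baer_sum_unique:
  assumes ext: "extension A C E\<^sub>1" "extension A C E\<^sub>2" "extension A C F" "extension A C G"
    and "is_baer_sum A E\<^sub>1 E\<^sub>2 F" "is_baer_sum A E\<^sub>1 E\<^sub>2 G"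
  shows "ext_equiv A C F G"
proof -
  interpret E1: group_extension A C E\<^sub>1 using ext(1) by unfold_locales
  interpret E2: group_extension A C E\<^sub>2 using ext(2) by unfold_locales
  let ?P = "fibre_product (mid E\<^sub>1) (rmap E\<^sub>1) (mid E\<^sub>2) (rmap E\<^sub>2)"
  interpret P: comm_group ?P by (rule comm_group_fibre_product_extensions[OF ext(1,2)])
  obtain h where h: "h \<in> hom ?P (mid F)"
    "\<And>a a'. a \<in> carrier A \<Longrightarrow> a' \<in> carrier A \<Longrightarrow> h (lmap E\<^sub>1 a, lmap E\<^sub>2 a') = lmap F (a \<otimes>\<^bsub>A\<^esub> a')"
    "\<And>b b'. b \<in> carrier (mid E\<^sub>1) \<Longrightarrow> b' \<in> carrier (mid E\<^sub>2) \<Longrightarrow> rmap E\<^sub>1 b = rmap E\<^sub>2 b' \<Longrightarrow>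
      rmap F (h (b, b')) = rmap E\<^sub>1 b"
    by (rule is_baer_sumE[OF assms(5)]) (rule that)
  obtain k where k: "k \<in> hom ?P (mid G)"
    "\<And>a a'. a \<in> carrier A \<Longrightarrow> a' \<in> carrier A \<Longrightarrow> k (lmap E\<^sub>1 a, lmap E\<^sub>2 a') = lmap G (a \<otimes>\<^bsub>A\<^esub> a')"
    "\<And>b b'. b \<in> carrier (mid E\<^sub>1) \<Longrightarrow> b' \<in> carrier (mid E\<^sub>2) \<Longrightarrow> rmap E\<^sub>1 b = rmap E\<^sub>2 b' \<Longrightarrow>
      rmap G (k (b, b')) = rmap E\<^sub>1 b"
    by (rule is_baer_sumE[OF assms(6)]) (rule that)
  show ?thesis
  proof (rule common_cover_imp_ext_equiv[OF ext(3,4) P.is_group h(1) k(1)])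
    fix p assume p: "p \<in> carrier ?P"
    obtain b b' where b: "p = (b, b')" "b \<in> carrier (mid E\<^sub>1)" "b' \<in> carrier (mid E\<^sub>2)"
      "rmap E\<^sub>1 b = rmap E\<^sub>2 b'"
      using p by (cases p) auto
    then show "rmap F (h p) = rmap G (k p)"
      by (simp add: h(3) k(3))
    assume "rmap F (h p) = \<one>\<^bsub>C\<^esub>"
    then have "rmap E\<^sub>1 b = \<one>\<^bsub>C\<^esub>"
      using b h(3) by simp
    then obtain a a' where "a \<in> carrier A" "lmap E\<^sub>1 a = b" "a' \<in> carrier A" "lmap E\<^sub>2 a' = b'"
      using b E1.ker_r E2.ker_r by metis
    then show "\<exists>a\<in>carrier A. h p = lmap F a \<and> k p = lmap G a"
      using h(2) k(2) b by (intro bexI[of _ "a \<otimes>\<^bsub>A\<^esub> a'"]) auto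
  next
    fix c assume c: "c \<in> carrier C"
    obtain b b' where "b \<in> carrier (mid E\<^sub>1)" "rmap E\<^sub>1 b = c" "b' \<in> carrier (mid E\<^sub>2)" "rmap E\<^sub>2 b' = c"
      using E1.r_surj[OF c] E2.r_surj[OF c] by metis
    then show "\<exists>p\<in>carrier ?P. rmap F (h p) = c"
      using h(3) by (intro bexI[of _ "(b, b')"]) auto
  next
    fix a assume "a \<in> carrier A"
    then show "\<exists>p\<in>carrier ?P. h p = lmap F a \<and> k p = lmap G a"
      using h(2)[of a "\<one>\<^bsub>A\<^esub>"] k(2)[of a "\<one>\<^bsub>A\<^esub>"]
      by (intro bexI[of _ "(lmap E\<^sub>1 a, lmap E\<^sub>2 \<one>\<^bsub>A\<^esub>)"]) (auto simp del: E1.l.hom_one E2.l.hom_one)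
  qed
qed

lemma codiagonal_hom:
  assumes "comm_group A"
  shows "codiagonal A \<in> hom (A \<times>\<times> A) A"
proof -
  interpret comm_group A by fact
  show ?thesis by (auto simp: hom_def codiagonal_def m_ac)
qed

lemma diagonal_hom: "diagonal \<in> hom C (C \<times>\<times> C)"
  by (auto simp: hom_def diagonal_def)

text \<open>
  The pair \<open>(b, b')\<close> goes to its class in the pushout, together with the common image in \<open>C\<close>
  that the pullback along the diagonal asks for.
\<close>

lemma
  assumes ext: "extension A C E\<^sub>1" "extension A C E\<^sub>2"
  shows extension_baer_sum: "extension A C (baer_sum A C E\<^sub>1 E\<^sub>2)"
    and is_baer_sum_baer_sum: "is_baer_sum A E\<^sub>1 E\<^sub>2 (baer_sum A C E\<^sub>1 E\<^sub>2)"
proof -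
  interpret E1: group_extension A C E\<^sub>1 using ext(1) by unfold_locales
  interpret E2: group_extension A C E\<^sub>2 using ext(2) by unfold_locales
  interpret S: group_extension "A \<times>\<times> A" "C \<times>\<times> C" "ext_sum E\<^sub>1 E\<^sub>2"
    using extension_ext_sum[OF ext] by unfold_locales
  define Q where "Q = pushout (A \<times>\<times> A) A (codiagonal A) (ext_sum E\<^sub>1 E\<^sub>2)"
  have Q: "extension A (C \<times>\<times> C) Q"
    unfolding Q_def by (intro S.extension_pushout codiagonal_hom E1.A.comm_group_axioms)
  then show "extension A C (baer_sum A C E\<^sub>1 E\<^sub>2)"
    unfolding baer_sum_def Q_def
    by (rule extension_pullback[OF _ E1.C.comm_group_axioms diagonal_hom])
  obtain k where k: "k \<in> hom (mid E\<^sub>1 \<times>\<times> mid E\<^sub>2) (mid Q)"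
    "\<And>a a'. a \<in> carrier A \<Longrightarrow> a' \<in> carrier A \<Longrightarrow> k (lmap E\<^sub>1 a, lmap E\<^sub>2 a') = lmap Q (a \<otimes>\<^bsub>A\<^esub> a')"
    "\<And>b b'. b \<in> carrier (mid E\<^sub>1) \<Longrightarrow> b' \<in> carrier (mid E\<^sub>2) \<Longrightarrow> rmap Q (k (b, b')) = (rmap E\<^sub>1 b, rmap E\<^sub>2 b')"
    using S.pushout_map[OF E1.A.comm_group_axioms codiagonal_hom[OF E1.A.comm_group_axioms]]
    by (auto simp: ext_sum_def codiagonal_def Q_def)
  show "is_baer_sum A E\<^sub>1 E\<^sub>2 (baer_sum A C E\<^sub>1 E\<^sub>2)"
    unfolding is_baer_sum_def
  proof (rule bexI[of _ "\<lambda>(b, b'). (k (b, b'), rmap E\<^sub>1 b)"])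
    show "(\<lambda>(b, b'). (k (b, b'), rmap E\<^sub>1 b))
      \<in> hom (fibre_product (mid E\<^sub>1) (rmap E\<^sub>1) (mid E\<^sub>2) (rmap E\<^sub>2)) (mid (baer_sum A C E\<^sub>1 E\<^sub>2))"
    proof (rule homI)
      fix x assume "x \<in> carrier (fibre_product (mid E\<^sub>1) (rmap E\<^sub>1) (mid E\<^sub>2) (rmap E\<^sub>2))"
      then show "(case x of (b, b') \<Rightarrow> (k (b, b'), rmap E\<^sub>1 b)) \<in> carrier (mid (baer_sum A C E\<^sub>1 E\<^sub>2))"
        using hom_in_carrier[OF k(1)] k(3)
        by (cases x) (auto simp: baer_sum_def Q_def[symmetric] diagonal_def)
    next
      fix x y assume "x \<in> carrier (fibre_product (mid E\<^sub>1) (rmap E\<^sub>1) (mid E\<^sub>2) (rmap E\<^sub>2))"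
        "y \<in> carrier (fibre_product (mid E\<^sub>1) (rmap E\<^sub>1) (mid E\<^sub>2) (rmap E\<^sub>2))"
      then show "(case x \<otimes>\<^bsub>fibre_product (mid E\<^sub>1) (rmap E\<^sub>1) (mid E\<^sub>2) (rmap E\<^sub>2)\<^esub> y of
            (b, b') \<Rightarrow> (k (b, b'), rmap E\<^sub>1 b))
          = (case x of (b, b') \<Rightarrow> (k (b, b'), rmap E\<^sub>1 b)) \<otimes>\<^bsub>mid (baer_sum A C E\<^sub>1 E\<^sub>2)\<^esub>
            (case y of (b, b') \<Rightarrow> (k (b, b'), rmap E\<^sub>1 b))"
        using hom_mult[OF k(1), of x y]
        by (cases x; cases y) (auto simp: baer_sum_def Q_def[symmetric])
    qed
  qed (auto simp: baer_sum_def k(2) Q_def[symmetric])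
qed


text \<open>
  Precomposing \<open>h\<close> with the two equivalences is enough.  Together with uniqueness this makes
  the addition of classes independent of the representatives.
\<close>

lemma is_baer_sum_cong:
  assumes ext: "extension A C E\<^sub>1" "extension A C E\<^sub>2"
    and "ext_equiv A C E\<^sub>1 F\<^sub>1" "ext_equiv A C E\<^sub>2 F\<^sub>2" "is_baer_sum A F\<^sub>1 F\<^sub>2 G"
  shows "is_baer_sum A E\<^sub>1 E\<^sub>2 G"
proof -
  obtain \<beta> where \<beta>: "\<beta> \<in> hom (mid E\<^sub>1) (mid F\<^sub>1)"
    "\<And>a. a \<in> carrier A \<Longrightarrow> \<beta> (lmap E\<^sub>1 a) = lmap F\<^sub>1 a"
    "\<And>b. b \<in> carrier (mid E\<^sub>1) \<Longrightarrow> rmap F\<^sub>1 (\<beta> b) = rmap E\<^sub>1 b"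
    using assms(3) by (auto simp: ext_equiv_def iso_def)
  obtain \<gamma> where \<gamma>: "\<gamma> \<in> hom (mid E\<^sub>2) (mid F\<^sub>2)"
    "\<And>a. a \<in> carrier A \<Longrightarrow> \<gamma> (lmap E\<^sub>2 a) = lmap F\<^sub>2 a"
    "\<And>b. b \<in> carrier (mid E\<^sub>2) \<Longrightarrow> rmap F\<^sub>2 (\<gamma> b) = rmap E\<^sub>2 b"
    using assms(4) by (auto simp: ext_equiv_def iso_def)
  obtain h where h: "h \<in> hom (fibre_product (mid F\<^sub>1) (rmap F\<^sub>1) (mid F\<^sub>2) (rmap F\<^sub>2)) (mid G)"
    "\<And>a a'. a \<in> carrier A \<Longrightarrow> a' \<in> carrier A \<Longrightarrow> h (lmap F\<^sub>1 a, lmap F\<^sub>2 a') = lmap G (a \<otimes>\<^bsub>A\<^esub> a')"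
    "\<And>b b'. b \<in> carrier (mid F\<^sub>1) \<Longrightarrow> b' \<in> carrier (mid F\<^sub>2) \<Longrightarrow> rmap F\<^sub>1 b = rmap F\<^sub>2 b' \<Longrightarrow>
      rmap G (h (b, b')) = rmap F\<^sub>1 b"
    by (rule is_baer_sumE[OF assms(5)]) (rule that)
  have "map_prod \<beta> \<gamma> \<in> hom (fibre_product (mid E\<^sub>1) (rmap E\<^sub>1) (mid E\<^sub>2) (rmap E\<^sub>2))
      (fibre_product (mid F\<^sub>1) (rmap F\<^sub>1) (mid F\<^sub>2) (rmap F\<^sub>2))"
    using hom_in_carrier[OF \<beta>(1)] hom_in_carrier[OF \<gamma>(1)] hom_mult[OF \<beta>(1)] hom_mult[OF \<gamma>(1)] \<beta>(3) \<gamma>(3)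
    by (intro homI) auto
  from Group.hom_compose[OF this h(1)] show ?thesis
    unfolding is_baer_sum_def
    using \<beta> \<gamma> h hom_in_carrier[OF \<beta>(1)] hom_in_carrier[OF \<gamma>(1)] by (intro bexI) auto
qed


section \<open>The group laws for Baer sums\<close>

lemma extension_split_extn:
  assumes "comm_group A" "comm_group C"
  shows "extension A C (split_extn A C)"
proof -
  interpret A: comm_group A by fact
  interpret C: comm_group C by fact
  show ?thesis
    unfolding extension_iff
    by (auto simp: split_extn_def comm_group_DirProd assms hom_def intro!: bexI[of _ "(\<one>\<^bsub>A\<^esub>, _)"])
qed

lemma is_baer_sum_split_left:
  assumes "extension A C E"
  shows "is_baer_sum A (split_extn A C) E E"
proof -
  interpret group_extension A C E using assms by unfold_locales
  show ?thesis
    unfolding is_baer_sum_def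
    by (rule bexI[of _ "\<lambda>((a, c), b). lmap E a \<otimes>\<^bsub>mid E\<^esub> b"])
      (auto simp: split_extn_def hom_def B.m_ac)
qed

text \<open>
  The pushout along \<open>a \<mapsto> -a\<close>, up to equivalence: as this is an automorphism of \<open>A\<close>, the
  middle group can stay the same.
\<close>

definition neg_extn :: "'a monoid \<Rightarrow> ('a, 'b, 'c) extn \<Rightarrow> ('a, 'b, 'c) extn" where
  "neg_extn A E = Extn (\<lambda>a. lmap E (inv\<^bsub>A\<^esub> a)) (mid E) (rmap E)"

lemma extension_neg_extn:
  assumes "extension A C E"
  shows "extension A C (neg_extn A E)"
proof -
  interpret group_extension A C E using assms by unfold_locales
  have "\<exists>a\<in>carrier A. inv\<^bsub>mid E\<^esub> (lmap E a) = b"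
    if b: "b \<in> carrier (mid E)" "rmap E b = \<one>\<^bsub>C\<^esub>" for b
  proof -
    obtain a where "a \<in> carrier A" "lmap E a = b" using ker_r[OF b] .
    then show ?thesis by (intro bexI[of _ "inv\<^bsub>A\<^esub> a"]) auto
  qed
  moreover have "a = \<one>\<^bsub>A\<^esub>" if "a \<in> carrier A" "lmap E (inv\<^bsub>A\<^esub> a) = \<one>\<^bsub>mid E\<^esub>" for a
    using that l_eq_one[of "inv\<^bsub>A\<^esub> a"] A.inv_eq_1_iff by (simp del: l.hom_inv)
  moreover have "\<exists>b\<in>carrier (mid E). rmap E b = c" if "c \<in> carrier C" for c
    using r_surj[OF that] by blast
  ultimately show ?thesis
    unfolding extension_iff
    by (auto simp: neg_extn_def A.comm_group_axioms B.comm_group_axioms C.comm_group_axioms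
        hom_def A.inv_mult B.inv_mult)
qed

lemma is_baer_sum_neg_left:
  assumes "extension A C E"
  shows "is_baer_sum A (neg_extn A E) E (split_extn A C)"
proof -
  interpret group_extension A C E using assms by unfold_locales
  \<comment> \<open>The element of \<open>A\<close> by which \<open>b'\<close> differs from \<open>b\<close>; the sign is the one that turns
    \<open>(-\<phi> a, \<phi> a')\<close> into \<open>a + a'\<close>.\<close>
  define d where "d = (\<lambda>(b, b'). inv_into (carrier A) (lmap E) (inv\<^bsub>mid E\<^esub> b \<otimes>\<^bsub>mid E\<^esub> b'))"
  let ?P = "fibre_product (mid E) (rmap E) (mid E) (rmap E)"
  have inj: "inj_on (lmap E) (carrier A)"
    by (simp add: l.inj_on_one_iff l_eq_one)
  have d_l: "d (b, b') = a"
    if "a \<in> carrier A" "lmap E a = inv\<^bsub>mid E\<^esub> b \<otimes>\<^bsub>mid E\<^esub> b'" for a b b'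
    using inv_into_f_f[OF inj that(1)] that(2) by (simp add: d_def)
  have d: "d (b, b') \<in> carrier A \<and> lmap E (d (b, b')) = inv\<^bsub>mid E\<^esub> b \<otimes>\<^bsub>mid E\<^esub> b'"
    if b: "b \<in> carrier (mid E)" "b' \<in> carrier (mid E)" "rmap E b = rmap E b'" for b b'
  proof -
    have "inv\<^bsub>mid E\<^esub> b \<otimes>\<^bsub>mid E\<^esub> b' \<in> carrier (mid E)" "rmap E (inv\<^bsub>mid E\<^esub> b \<otimes>\<^bsub>mid E\<^esub> b') = \<one>\<^bsub>C\<^esub>"
      using b by auto
    then obtain a where "a \<in> carrier A" "lmap E a = inv\<^bsub>mid E\<^esub> b \<otimes>\<^bsub>mid E\<^esub> b'"
      by (rule ker_r)
    then show ?thesis using d_l[of a b b'] by simp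
  qed
  have d_mult: "d (b \<otimes>\<^bsub>mid E\<^esub> b1, b' \<otimes>\<^bsub>mid E\<^esub> b1') = d (b, b') \<otimes>\<^bsub>A\<^esub> d (b1, b1')"
    if "b \<in> carrier (mid E)" "b' \<in> carrier (mid E)" "rmap E b = rmap E b'"
      "b1 \<in> carrier (mid E)" "b1' \<in> carrier (mid E)" "rmap E b1 = rmap E b1'" for b b' b1 b1'
    using that d[of b b'] d[of b1 b1'] by (intro d_l) (auto simp: B.inv_mult B.m_ac)
  have "(\<lambda>(b, b'). (d (b, b'), rmap E b)) \<in> hom ?P (A \<times>\<times> C)"
    using d by (intro homI) (auto simp: d_mult)
  moreover have "d (lmap E (inv\<^bsub>A\<^esub> a), lmap E a') = a \<otimes>\<^bsub>A\<^esub> a'"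
    if "a \<in> carrier A" "a' \<in> carrier A" for a a'
    using that by (intro d_l) auto
  ultimately show ?thesis
    unfolding is_baer_sum_def
    by (intro bexI[of _ "\<lambda>(b, b'). (d (b, b'), rmap E b)"]) (auto simp: neg_extn_def split_extn_def simp del: l.hom_inv)
qed

text \<open>
  The fibre product of all three middle groups covers both bracketings, and over \<open>0\<close> both
  covering maps send \<open>(\<phi>\<^sub>1 a, \<phi>\<^sub>2 b, \<phi>\<^sub>3 c)\<close> to the image of \<open>a + b + c\<close>.
\<close>

lemma is_baer_sum_assoc:
  assumes ext: "extension A C E\<^sub>1" "extension A C E\<^sub>2" "extension A C E\<^sub>3"
    "extension A C F" "extension A C G" "extension A C F'" "extension A C G'"
    and F: "is_baer_sum A E\<^sub>1 E\<^sub>2 F" and F': "is_baer_sum A F E\<^sub>3 F'"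
    and G: "is_baer_sum A E\<^sub>2 E\<^sub>3 G" and G': "is_baer_sum A E\<^sub>1 G G'"
  shows "ext_equiv A C F' G'"
proof -
  interpret E1: group_extension A C E\<^sub>1 using ext(1) by unfold_locales
  interpret E2: group_extension A C E\<^sub>2 using ext(2) by unfold_locales
  interpret E3: group_extension A C E\<^sub>3 using ext(3) by unfold_locales
  let ?P = "fibre_product (mid E\<^sub>2) (rmap E\<^sub>2) (mid E\<^sub>3) (rmap E\<^sub>3)"
  \<comment> \<open>The triples with a common image in \<open>C\<close>: all that \<open>?T\<close> demands is \<open>\<psi>\<^sub>1 x = \<psi>\<^sub>2 y\<close>, the rest is in \<open>?P\<close>.\<close>
  let ?T = "fibre_product (mid E\<^sub>1) (rmap E\<^sub>1) ?P (rmap E\<^sub>2 \<circ> fst)"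
  interpret T: comm_group ?T
    by (intro fibre_product_comm_group[where C = C] comm_group_fibre_product_extensions[OF ext(2,3)]
        Group.hom_compose[OF fibre_product_hom(1)] E1.r.homh E2.r.homh
        E1.B.comm_group_axioms E1.C.comm_group_axioms)
  obtain f where f: "f \<in> hom (fibre_product (mid E\<^sub>1) (rmap E\<^sub>1) (mid E\<^sub>2) (rmap E\<^sub>2)) (mid F)"
    "\<And>a a'. a \<in> carrier A \<Longrightarrow> a' \<in> carrier A \<Longrightarrow> f (lmap E\<^sub>1 a, lmap E\<^sub>2 a') = lmap F (a \<otimes>\<^bsub>A\<^esub> a')"
    "\<And>b b'. b \<in> carrier (mid E\<^sub>1) \<Longrightarrow> b' \<in> carrier (mid E\<^sub>2) \<Longrightarrow> rmap E\<^sub>1 b = rmap E\<^sub>2 b' \<Longrightarrow>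
      rmap F (f (b, b')) = rmap E\<^sub>1 b"
    by (rule is_baer_sumE[OF F]) (rule that)
  obtain f' where f': "f' \<in> hom (fibre_product (mid F) (rmap F) (mid E\<^sub>3) (rmap E\<^sub>3)) (mid F')"
    "\<And>a a'. a \<in> carrier A \<Longrightarrow> a' \<in> carrier A \<Longrightarrow> f' (lmap F a, lmap E\<^sub>3 a') = lmap F' (a \<otimes>\<^bsub>A\<^esub> a')"
    "\<And>b b'. b \<in> carrier (mid F) \<Longrightarrow> b' \<in> carrier (mid E\<^sub>3) \<Longrightarrow> rmap F b = rmap E\<^sub>3 b' \<Longrightarrow>
      rmap F' (f' (b, b')) = rmap F b"
    by (rule is_baer_sumE[OF F']) (rule that)
  obtain g where g: "g \<in> hom ?P (mid G)"
    "\<And>a a'. a \<in> carrier A \<Longrightarrow> a' \<in> carrier A \<Longrightarrow> g (lmap E\<^sub>2 a, lmap E\<^sub>3 a') = lmap G (a \<otimes>\<^bsub>A\<^esub> a')"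
    "\<And>b b'. b \<in> carrier (mid E\<^sub>2) \<Longrightarrow> b' \<in> carrier (mid E\<^sub>3) \<Longrightarrow> rmap E\<^sub>2 b = rmap E\<^sub>3 b' \<Longrightarrow>
      rmap G (g (b, b')) = rmap E\<^sub>2 b"
    by (rule is_baer_sumE[OF G]) (rule that)
  obtain g' where g': "g' \<in> hom (fibre_product (mid E\<^sub>1) (rmap E\<^sub>1) (mid G) (rmap G)) (mid G')"
    "\<And>a a'. a \<in> carrier A \<Longrightarrow> a' \<in> carrier A \<Longrightarrow> g' (lmap E\<^sub>1 a, lmap G a') = lmap G' (a \<otimes>\<^bsub>A\<^esub> a')"
    "\<And>b b'. b \<in> carrier (mid E\<^sub>1) \<Longrightarrow> b' \<in> carrier (mid G) \<Longrightarrow> rmap E\<^sub>1 b = rmap G b' \<Longrightarrow>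
      rmap G' (g' (b, b')) = rmap E\<^sub>1 b"
    by (rule is_baer_sumE[OF G']) (rule that)
  define u where "u = (\<lambda>(x, y, z). f' (f (x, y), z))"
  define v where "v = (\<lambda>(x, y, z). g' (x, g (y, z)))"
  have f_c: "f (x, y) \<in> carrier (mid F)"
    if "x \<in> carrier (mid E\<^sub>1)" "y \<in> carrier (mid E\<^sub>2)" "rmap E\<^sub>1 x = rmap E\<^sub>2 y" for x y
    using that hom_in_carrier[OF f(1), of "(x, y)"] by simp
  have g_c: "g (y, z) \<in> carrier (mid G)"
    if "y \<in> carrier (mid E\<^sub>2)" "z \<in> carrier (mid E\<^sub>3)" "rmap E\<^sub>2 y = rmap E\<^sub>3 z" for y z
    using that hom_in_carrier[OF g(1), of "(y, z)"] by simp
  have u: "u \<in> hom ?T (mid F')"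
  proof (rule homI)
    fix p assume "p \<in> carrier ?T"
    then show "u p \<in> carrier (mid F')"
      using hom_in_carrier[OF f'(1)] f(3) f_c by (cases p) (auto simp: u_def)
  next
    fix p q assume "p \<in> carrier ?T" "q \<in> carrier ?T"
    then obtain x y z x' y' z' where p: "p = (x, y, z)" "x \<in> carrier (mid E\<^sub>1)" "y \<in> carrier (mid E\<^sub>2)"
      "z \<in> carrier (mid E\<^sub>3)" "rmap E\<^sub>1 x = rmap E\<^sub>2 y" "rmap E\<^sub>2 y = rmap E\<^sub>3 z"
      and q: "q = (x', y', z')" "x' \<in> carrier (mid E\<^sub>1)" "y' \<in> carrier (mid E\<^sub>2)"
      "z' \<in> carrier (mid E\<^sub>3)" "rmap E\<^sub>1 x' = rmap E\<^sub>2 y'" "rmap E\<^sub>2 y' = rmap E\<^sub>3 z'"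
      by (cases p; cases q) auto
    have "f (x \<otimes>\<^bsub>mid E\<^sub>1\<^esub> x', y \<otimes>\<^bsub>mid E\<^sub>2\<^esub> y') = f (x, y) \<otimes>\<^bsub>mid F\<^esub> f (x', y')"
      using p q hom_mult[OF f(1), of "(x, y)" "(x', y')"] by simp
    then show "u (p \<otimes>\<^bsub>?T\<^esub> q) = u p \<otimes>\<^bsub>mid F'\<^esub> u q"
      using p q f_c f(3) hom_mult[OF f'(1), of "(f (x, y), z)" "(f (x', y'), z')"] by (simp add: u_def)
  qed
  have v: "v \<in> hom ?T (mid G')"
  proof (rule homI)
    fix p assume "p \<in> carrier ?T"
    then show "v p \<in> carrier (mid G')"
      using hom_in_carrier[OF g'(1)] g(3) g_c by (cases p) (auto simp: v_def)
  next
    fix p q assume "p \<in> carrier ?T" "q \<in> carrier ?T"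
    then obtain x y z x' y' z' where p: "p = (x, y, z)" "x \<in> carrier (mid E\<^sub>1)" "y \<in> carrier (mid E\<^sub>2)"
      "z \<in> carrier (mid E\<^sub>3)" "rmap E\<^sub>1 x = rmap E\<^sub>2 y" "rmap E\<^sub>2 y = rmap E\<^sub>3 z"
      and q: "q = (x', y', z')" "x' \<in> carrier (mid E\<^sub>1)" "y' \<in> carrier (mid E\<^sub>2)"
      "z' \<in> carrier (mid E\<^sub>3)" "rmap E\<^sub>1 x' = rmap E\<^sub>2 y'" "rmap E\<^sub>2 y' = rmap E\<^sub>3 z'"
      by (cases p; cases q) auto
    have "g (y \<otimes>\<^bsub>mid E\<^sub>2\<^esub> y', z \<otimes>\<^bsub>mid E\<^sub>3\<^esub> z') = g (y, z) \<otimes>\<^bsub>mid G\<^esub> g (y', z')"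
      using p q hom_mult[OF g(1), of "(y, z)" "(y', z')"] by simp
    then show "v (p \<otimes>\<^bsub>?T\<^esub> q) = v p \<otimes>\<^bsub>mid G'\<^esub> v q"
      using p q g_c g(3) hom_mult[OF g'(1), of "(x, g (y, z))" "(x', g (y', z'))"] by (simp add: v_def)
  qed
  have u_r: "rmap F' (u (x, y, z)) = rmap E\<^sub>1 x" and v_r: "rmap G' (v (x, y, z)) = rmap E\<^sub>1 x"
    if "(x, y, z) \<in> carrier ?T" for x y z
    using that f_c f(3) f'(3) g_c g(3) g'(3) by (auto simp: u_def v_def)
  have u_l: "u (lmap E\<^sub>1 a, lmap E\<^sub>2 b, lmap E\<^sub>3 c) = lmap F' (a \<otimes>\<^bsub>A\<^esub> (b \<otimes>\<^bsub>A\<^esub> c))"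
    and v_l: "v (lmap E\<^sub>1 a, lmap E\<^sub>2 b, lmap E\<^sub>3 c) = lmap G' (a \<otimes>\<^bsub>A\<^esub> (b \<otimes>\<^bsub>A\<^esub> c))"
    if "a \<in> carrier A" "b \<in> carrier A" "c \<in> carrier A" for a b c
    using that by (simp_all add: u_def v_def f(2) f'(2) g(2) g'(2) E1.A.m_assoc)
  show ?thesis
  proof (rule common_cover_imp_ext_equiv[OF ext(6,7) T.is_group u v])
    fix p assume p: "p \<in> carrier ?T"
    obtain x y z where xyz: "p = (x, y, z)" by (cases p)
    show "rmap F' (u p) = rmap G' (v p)"
      using p u_r v_r by (simp add: xyz)
    assume "rmap F' (u p) = \<one>\<^bsub>C\<^esub>"
    then have "rmap E\<^sub>1 x = \<one>\<^bsub>C\<^esub>"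
      using p u_r by (simp add: xyz)
    then have "x \<in> carrier (mid E\<^sub>1)" "rmap E\<^sub>1 x = \<one>\<^bsub>C\<^esub>" "y \<in> carrier (mid E\<^sub>2)" "rmap E\<^sub>2 y = \<one>\<^bsub>C\<^esub>"
      "z \<in> carrier (mid E\<^sub>3)" "rmap E\<^sub>3 z = \<one>\<^bsub>C\<^esub>"
      using p by (auto simp: xyz)
    then obtain a b c where "a \<in> carrier A" "b \<in> carrier A" "c \<in> carrier A"
      "p = (lmap E\<^sub>1 a, lmap E\<^sub>2 b, lmap E\<^sub>3 c)"
      unfolding xyz by (metis E1.ker_r E2.ker_r E3.ker_r)
    then show "\<exists>a\<in>carrier A. u p = lmap F' a \<and> v p = lmap G' a"
      using u_l v_l E1.A.m_closed by metis
  next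
    fix c assume c: "c \<in> carrier C"
    obtain x where "x \<in> carrier (mid E\<^sub>1)" "rmap E\<^sub>1 x = c" using E1.r_surj[OF c] .
    moreover obtain y where "y \<in> carrier (mid E\<^sub>2)" "rmap E\<^sub>2 y = c" using E2.r_surj[OF c] .
    moreover obtain z where "z \<in> carrier (mid E\<^sub>3)" "rmap E\<^sub>3 z = c" using E3.r_surj[OF c] .
    ultimately show "\<exists>p\<in>carrier ?T. rmap F' (u p) = c"
      using u_r by (intro bexI[of _ "(x, y, z)"]) auto
  next
    \<comment> \<open>The other two coordinates of the preimage are \<open>\<phi>\<^sub>2 0\<close> and \<open>\<phi>\<^sub>3 0\<close>, kept in this form to match \<open>u_l\<close> and \<open>v_l\<close>.\<close>
    fix a assume a: "a \<in> carrier A"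
    then show "\<exists>p\<in>carrier ?T. u p = lmap F' a \<and> v p = lmap G' a"
      using u_l[OF a E1.A.one_closed E1.A.one_closed] v_l[OF a E1.A.one_closed E1.A.one_closed]
      by (intro bexI[of _ "(lmap E\<^sub>1 a, lmap E\<^sub>2 \<one>\<^bsub>A\<^esub>, lmap E\<^sub>3 \<one>\<^bsub>A\<^esub>)"])
        (auto simp del: E2.l.hom_one E3.l.hom_one)
  qed
qed


section \<open>The group of extensions\<close>

text \<open>
  The product in \<open>Ext C A\<close> is a union over all representatives.  It collapses because they all
  contribute the same class and both classes are nonempty.
\<close>

lemma ext_class_mult:
  assumes ext: "extension A C E\<^sub>1" "extension A C E\<^sub>2"
  shows "ext_class A C E\<^sub>1 \<otimes>\<^bsub>Ext C A\<^esub> ext_class A C E\<^sub>2 = ext_class A C (baer_sum A C E\<^sub>1 E\<^sub>2)"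
proof -
  have "ext_class A C (baer_sum A C F\<^sub>1 F\<^sub>2) = ext_class A C (baer_sum A C E\<^sub>1 E\<^sub>2)"
    if F: "F\<^sub>1 \<in> ext_class A C E\<^sub>1" "F\<^sub>2 \<in> ext_class A C E\<^sub>2" for F\<^sub>1 F\<^sub>2
  proof -
    have F: "extension A C F\<^sub>1" "extension A C F\<^sub>2" "ext_equiv A C E\<^sub>1 F\<^sub>1" "ext_equiv A C E\<^sub>2 F\<^sub>2"
      using F by (auto simp: ext_class_def)
    have "is_baer_sum A E\<^sub>1 E\<^sub>2 (baer_sum A C F\<^sub>1 F\<^sub>2)"
      by (rule is_baer_sum_cong[OF ext F(3,4) is_baer_sum_baer_sum[OF F(1,2)]])
    then have "ext_equiv A C (baer_sum A C F\<^sub>1 F\<^sub>2) (baer_sum A C E\<^sub>1 E\<^sub>2)"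
      by (rule is_baer_sum_unique[OF ext extension_baer_sum[OF F(1,2)] extension_baer_sum[OF ext]
            _ is_baer_sum_baer_sum[OF ext]])
    then show ?thesis
      by (simp add: ext_class_eq_iff extension_baer_sum F ext)
  qed
  moreover obtain F\<^sub>1 where "F\<^sub>1 \<in> ext_class A C E\<^sub>1"
    using ext(1) by (rule ext_class_nonempty)
  moreover obtain F\<^sub>2 where "F\<^sub>2 \<in> ext_class A C E\<^sub>2"
    using ext(2) by (rule ext_class_nonempty)
  ultimately have "(\<Union>F\<^sub>1\<in>ext_class A C E\<^sub>1. \<Union>F\<^sub>2\<in>ext_class A C E\<^sub>2. ext_class A C (baer_sum A C F\<^sub>1 F\<^sub>2))
      = ext_class A C (baer_sum A C E\<^sub>1 E\<^sub>2)"
    by blast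
  then show ?thesis
    by (simp add: Ext_def)
qed

lemma ext_class_mult_eq:
  assumes ext: "extension A C E\<^sub>1" "extension A C E\<^sub>2" "extension A C E\<^sub>3"
    and "is_baer_sum A E\<^sub>1 E\<^sub>2 E\<^sub>3"
  shows "ext_class A C E\<^sub>1 \<otimes>\<^bsub>Ext C A\<^esub> ext_class A C E\<^sub>2 = ext_class A C E\<^sub>3"
proof -
  have "ext_equiv A C (baer_sum A C E\<^sub>1 E\<^sub>2) E\<^sub>3"
    by (rule is_baer_sum_unique[OF ext(1,2) extension_baer_sum[OF ext(1,2)] ext(3)
          is_baer_sum_baer_sum[OF ext(1,2)] assms(4)])
  then show ?thesis
    by (simp add: ext_class_mult ext ext_class_eq_iff extension_baer_sum)
qed

lemma Ext_carrierE:
  fixes A :: "'a monoid" and C :: "'c monoid"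
  assumes "X \<in> carrier (Ext C A)"
  obtains E :: "('a, 'a \<times> 'c, 'c) extn" where "extension A C E" "X = ext_class A C E"
  using assms by (auto simp: Ext_def)

lemma one_Ext: "\<one>\<^bsub>Ext C A\<^esub> = ext_class A C (split_extn A C)"
  by (simp add: Ext_def)

lemma group_Ext:
  fixes A :: "'a monoid" and C :: "'c monoid"
  assumes AC: "comm_group A" "comm_group C"
  shows "group (Ext C A)"
proof (rule groupI)
  fix X Y assume "X \<in> carrier (Ext C A)" "Y \<in> carrier (Ext C A)"
  then obtain E F :: "('a, 'a \<times> 'c, 'c) extn" where
    ext: "extension A C E" "extension A C F" and "X = ext_class A C E" "Y = ext_class A C F"
    by (metis Ext_carrierE)
  then show "X \<otimes>\<^bsub>Ext C A\<^esub> Y \<in> carrier (Ext C A)"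
    using ext_class_in_Ext[OF extension_baer_sum[OF ext]] by (simp add: ext_class_mult)
next
  show "\<one>\<^bsub>Ext C A\<^esub> \<in> carrier (Ext C A)"
    unfolding one_Ext by (intro ext_class_in_Ext extension_split_extn AC)
next
  fix X Y Z assume "X \<in> carrier (Ext C A)" "Y \<in> carrier (Ext C A)" "Z \<in> carrier (Ext C A)"
  then obtain E F G :: "('a, 'a \<times> 'c, 'c) extn" where
    ext: "extension A C E" "extension A C F" "extension A C G"
    and XYZ: "X = ext_class A C E" "Y = ext_class A C F" "Z = ext_class A C G"
    by (metis Ext_carrierE)
  note EF = extension_baer_sum[OF ext(1,2)] and FG = extension_baer_sum[OF ext(2,3)]
  have "ext_equiv A C (baer_sum A C (baer_sum A C E F) G) (baer_sum A C E (baer_sum A C F G))"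
    by (rule is_baer_sum_assoc[OF ext EF FG extension_baer_sum[OF EF ext(3)] extension_baer_sum[OF ext(1) FG]
          is_baer_sum_baer_sum[OF ext(1,2)] is_baer_sum_baer_sum[OF EF ext(3)]
          is_baer_sum_baer_sum[OF ext(2,3)] is_baer_sum_baer_sum[OF ext(1) FG]])
  then show "X \<otimes>\<^bsub>Ext C A\<^esub> Y \<otimes>\<^bsub>Ext C A\<^esub> Z = X \<otimes>\<^bsub>Ext C A\<^esub> (Y \<otimes>\<^bsub>Ext C A\<^esub> Z)"
    by (simp add: XYZ ext_class_mult ext EF FG ext_class_eq_iff extension_baer_sum)
next
  fix X assume "X \<in> carrier (Ext C A)"
  then obtain E :: "('a, 'a \<times> 'c, 'c) extn" where ext: "extension A C E" and X: "X = ext_class A C E"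
    by (rule Ext_carrierE)
  show "\<one>\<^bsub>Ext C A\<^esub> \<otimes>\<^bsub>Ext C A\<^esub> X = X"
    unfolding one_Ext X
    by (intro ext_class_mult_eq extension_split_extn AC ext is_baer_sum_split_left[OF ext])
  have "ext_class A C (neg_extn A E) \<otimes>\<^bsub>Ext C A\<^esub> X = \<one>\<^bsub>Ext C A\<^esub>"
    unfolding one_Ext X
    by (intro ext_class_mult_eq extension_split_extn AC ext extension_neg_extn is_baer_sum_neg_left[OF ext])
  then show "\<exists>Y\<in>carrier (Ext C A). Y \<otimes>\<^bsub>Ext C A\<^esub> X = \<one>\<^bsub>Ext C A\<^esub>"
    by (intro bexI[of _ "ext_class A C (neg_extn A E)"] ext_class_in_Ext extension_neg_extn ext)
qed

lemma inv_Ext: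
  assumes "extension A C E"
  shows "inv\<^bsub>Ext C A\<^esub> (ext_class A C E) = ext_class A C (neg_extn A E)"
proof -
  have AC: "comm_group A" "comm_group C"
    using assms by (auto simp: extension_def)
  interpret group "Ext C A" by (rule group_Ext[OF AC])
  show ?thesis
    by (intro inv_equality ext_class_in_Ext extension_neg_extn assms)
      (simp add: one_Ext ext_class_mult_eq extension_neg_extn extension_split_extn AC assms
        is_baer_sum_neg_left[OF assms])
qed


section \<open>The subgroup of t-extensions\<close>

lemma carrier_torsion_iff:
  "x \<in> carrier (torsion G) \<longleftrightarrow> x \<in> carrier G \<and> (\<exists>n::nat. n > 0 \<and> x [^]\<^bsub>G\<^esub> n = \<one>\<^bsub>G\<^esub>)"
  by (simp add: torsion_def)

lemma hom_torsion:
  assumes "group_hom G H h" "x \<in> carrier (torsion G)"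
  shows "h x \<in> carrier (torsion H)"
proof -
  interpret group_hom G H h by fact
  obtain n :: nat where "x \<in> carrier G" "n > 0" "x [^]\<^bsub>G\<^esub> n = \<one>\<^bsub>G\<^esub>"
    using assms by (auto simp: carrier_torsion_iff)
  then show ?thesis
    by (auto simp: carrier_torsion_iff simp flip: hom_nat_pow)
qed

lemma torsion_simps [simp]:
  "\<one>\<^bsub>torsion G\<^esub> = \<one>\<^bsub>G\<^esub>" "x \<otimes>\<^bsub>torsion G\<^esub> y = x \<otimes>\<^bsub>G\<^esub> y"
  by (simp_all add: torsion_def)

text \<open>
  Exactness of the torsion sequence can fail only at \<open>tC\<close>: if \<open>\<phi> a\<close> is torsion then so is \<open>a\<close>,
  because \<open>\<phi>\<close> is injective, and hence every torsion element of the kernel of \<open>\<psi>\<close> comes from \<open>tA\<close>.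
\<close>

lemma t_extension_iff:
  "t_extension A C E \<longleftrightarrow>
     extension A C E \<and> carrier (torsion C) \<subseteq> rmap E ` carrier (torsion (mid E))"
proof (cases "extension A C E")
  case True
  then interpret group_extension A C E by unfold_locales
  have sub: "carrier (torsion G) \<subseteq> carrier G" for G :: "'z monoid"
    by (auto simp: carrier_torsion_iff)
  have A: "a \<in> carrier (torsion A)" if a: "a \<in> carrier A" "lmap E a \<in> carrier (torsion (mid E))" for a
  proof -
    obtain n :: nat where "n > 0" "lmap E (a [^]\<^bsub>A\<^esub> n) = \<one>\<^bsub>mid E\<^esub>"
      using a by (auto simp: carrier_torsion_iff l.hom_nat_pow)
    then show ?thesis
      using a by (auto simp: carrier_torsion_iff l_eq_one)
  qed
  have "inj_on (lmap E) (carrier A)"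
    by (simp add: l.inj_on_one_iff l_eq_one)
  then have "inj_on (lmap E) (carrier (torsion A))"
    by (rule inj_on_subset[OF _ sub])
  moreover have "lmap E \<in> hom (torsion A) (torsion (mid E))"
    using hom_torsion[OF l.group_hom_axioms]
    by (intro homI) (auto simp: carrier_torsion_iff)
  ultimately have l: "lmap E \<in> mon (torsion A) (torsion (mid E))"
    by (simp add: mon_def)
  have k: "lmap E ` carrier (torsion A) = kernel (torsion (mid E)) (torsion C) (rmap E)"
  proof (intro equalityI subsetI)
    fix b assume "b \<in> lmap E ` carrier (torsion A)"
    then show "b \<in> kernel (torsion (mid E)) (torsion C) (rmap E)"
      using hom_torsion[OF l.group_hom_axioms] by (auto simp: kernel_def carrier_torsion_iff)
  next
    fix b assume b: "b \<in> kernel (torsion (mid E)) (torsion C) (rmap E)"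
    then obtain a where "a \<in> carrier A" "lmap E a = b"
      using ker_r[of b] by (auto simp: kernel_def carrier_torsion_iff)
    then show "b \<in> lmap E ` carrier (torsion A)"
      using b A by (auto simp: kernel_def)
  qed
  have r: "rmap E ` carrier (torsion (mid E)) \<subseteq> carrier (torsion C)"
    "rmap E \<in> hom (torsion (mid E)) (torsion C)"
    using hom_torsion[OF r.group_hom_axioms] by (auto simp: hom_def carrier_torsion_iff)
  show ?thesis
    using True l k r by (auto simp: t_extension_def short_exact_def epi_def)
qed (simp add: t_extension_def)

lemma t_extension_ext_equiv:
  assumes "t_extension A C E" "extension A C F" "ext_equiv A C E F"
  shows "t_extension A C F"
proof -
  obtain \<beta> where \<beta>: "\<beta> \<in> hom (mid E) (mid F)"
    "\<And>b. b \<in> carrier (mid E) \<Longrightarrow> rmap F (\<beta> b) = rmap E b"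
    using assms(3) by (auto simp: ext_equiv_def iso_def)
  interpret group_hom "mid E" "mid F" \<beta>
    using assms \<beta>(1)
    by (intro group_hom.intro group_hom_axioms.intro) (auto simp: t_extension_iff extension_def comm_group_def)
  have "c \<in> rmap F ` carrier (torsion (mid F))" if c: "c \<in> carrier (torsion C)" for c
  proof -
    obtain b where "b \<in> carrier (torsion (mid E))" "rmap E b = c"
      using assms(1) c by (auto simp: t_extension_iff)
    then show ?thesis
      using \<beta>(2)[of b] hom_torsion[OF group_hom_axioms, of b] by (intro image_eqI[of _ _ "\<beta> b"]) (auto simp: carrier_torsion_iff)
  qed
  then show ?thesis
    using assms(2) by (auto simp: t_extension_iff)
qed

text \<open>
  Being a t-extension is invariant under equivalence, so one representative
  decides for the whole class.
\<close>

lemma ext_class_in_Ext_t_iff: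
  fixes A :: "'a monoid" and C :: "'c monoid"
  assumes "extension A C E"
  shows "ext_class A C E \<in> Ext_t C A \<longleftrightarrow> t_extension A C E"
proof
  assume "ext_class A C E \<in> Ext_t C A"
  then obtain F :: "('a, 'a \<times> 'c, 'c) extn" where "ext_equiv A C E F" "t_extension A C F"
    by (auto simp: Ext_t_def ext_class_def)
  then show "t_extension A C E"
    using t_extension_ext_equiv[OF _ assms] ext_equiv_sym[OF assms] by blast
next
  assume E: "t_extension A C E"
  obtain F :: "('a, 'a \<times> 'c, 'c) extn"
    where "extension A C F" "ext_equiv A C E F" "F \<in> ext_class A C E"
    using assms by (rule ext_class_nonempty)
  then show "ext_class A C E \<in> Ext_t C A"
    using t_extension_ext_equiv[OF E] ext_class_in_Ext[OF assms] by (auto simp: Ext_t_def)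
qed

lemma Ext_tE:
  fixes A :: "'a monoid" and C :: "'c monoid"
  assumes "X \<in> Ext_t C A"
  obtains E :: "('a, 'a \<times> 'c, 'c) extn" where "t_extension A C E" "X = ext_class A C E"
proof -
  have "X \<in> carrier (Ext C A)"
    using assms by (simp add: Ext_t_def)
  then obtain E :: "('a, 'a \<times> 'c, 'c) extn" where E: "extension A C E" "X = ext_class A C E"
    by (rule Ext_carrierE)
  with assms show thesis
    by (intro that[of E]) (simp_all add: ext_class_in_Ext_t_iff)
qed

text \<open>
  A common multiple of the two orders kills the pair.
\<close>

lemma torsion_fibre_product:
  assumes "monoid B" "monoid D"
    and b: "b \<in> carrier (torsion B)" and d: "d \<in> carrier (torsion D)" and eq: "f b = g d"
  shows "(b, d) \<in> carrier (torsion (fibre_product B f D g))"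
proof -
  interpret B: monoid B by fact
  interpret D: monoid D by fact
  obtain m n :: nat where mn: "m > 0" "b [^]\<^bsub>B\<^esub> m = \<one>\<^bsub>B\<^esub>" "n > 0" "d [^]\<^bsub>D\<^esub> n = \<one>\<^bsub>D\<^esub>"
    using b d by (auto simp: carrier_torsion_iff)
  have bd: "b \<in> carrier B" "d \<in> carrier D"
    using b d by (auto simp: carrier_torsion_iff)
  have pow: "(b, d) [^]\<^bsub>fibre_product B f D g\<^esub> k = (b [^]\<^bsub>B\<^esub> k, d [^]\<^bsub>D\<^esub> k)" for k :: nat
    by (induction k) (simp_all add: nat_pow_def)
  have "b [^]\<^bsub>B\<^esub> (m * n) = \<one>\<^bsub>B\<^esub>" "d [^]\<^bsub>D\<^esub> (m * n) = \<one>\<^bsub>D\<^esub>"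
    using mn B.nat_pow_pow[OF bd(1), of m n] D.nat_pow_pow[OF bd(2), of n m]
    by (simp_all add: mult.commute)
  then show ?thesis
    using mn bd eq unfolding carrier_torsion_iff by (auto simp: pow intro!: exI[of _ "m * n"])
qed

lemma t_extension_baer_sum:
  assumes E: "t_extension A C E\<^sub>1" "t_extension A C E\<^sub>2"
  shows "t_extension A C (baer_sum A C E\<^sub>1 E\<^sub>2)"
proof -
  have ext: "extension A C E\<^sub>1" "extension A C E\<^sub>2"
    using E by (auto simp: t_extension_iff)
  let ?P = "fibre_product (mid E\<^sub>1) (rmap E\<^sub>1) (mid E\<^sub>2) (rmap E\<^sub>2)"
  let ?S = "baer_sum A C E\<^sub>1 E\<^sub>2"
  interpret S: group_extension A C ?S using extension_baer_sum[OF ext] by unfold_locales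
  interpret P: comm_group ?P by (rule comm_group_fibre_product_extensions[OF ext])
  obtain h where h: "h \<in> hom ?P (mid ?S)"
    "\<And>b b'. b \<in> carrier (mid E\<^sub>1) \<Longrightarrow> b' \<in> carrier (mid E\<^sub>2) \<Longrightarrow> rmap E\<^sub>1 b = rmap E\<^sub>2 b' \<Longrightarrow>
      rmap ?S (h (b, b')) = rmap E\<^sub>1 b"
    using is_baer_sum_baer_sum[OF ext] unfolding is_baer_sum_def by blast
  interpret h: group_hom ?P "mid ?S" h using h(1) by unfold_locales
  have "c \<in> rmap ?S ` carrier (torsion (mid ?S))" if c: "c \<in> carrier (torsion C)" for c
  proof -
    have "c \<in> rmap E\<^sub>1 ` carrier (torsion (mid E\<^sub>1))" "c \<in> rmap E\<^sub>2 ` carrier (torsion (mid E\<^sub>2))"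
      using E c by (auto simp: t_extension_iff)
    then obtain b b' where b: "b \<in> carrier (torsion (mid E\<^sub>1))" "rmap E\<^sub>1 b = c"
      "b' \<in> carrier (torsion (mid E\<^sub>2))" "rmap E\<^sub>2 b' = c"
      by auto
    then have "(b, b') \<in> carrier (torsion ?P)"
      using ext
      by (intro torsion_fibre_product) (auto simp: extension_def comm_group_def comm_monoid_def)
    then have "h (b, b') \<in> carrier (torsion (mid ?S))"
      by (rule hom_torsion[OF h.group_hom_axioms])
    moreover have "rmap ?S (h (b, b')) = c"
      using b by (simp add: h(2) carrier_torsion_iff)
    ultimately show ?thesis by blast
  qed
  then show ?thesis
    using S.ext by (auto simp: t_extension_iff)
qed

lemma t_extension_neg_extn:
  assumes "t_extension A C E"
  shows "t_extension A C (neg_extn A E)"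
proof -
  have "extension A C (neg_extn A E)"
    using assms by (simp add: t_extension_iff extension_neg_extn)
  then show ?thesis
    using assms by (simp add: t_extension_iff neg_extn_def)
qed

lemma t_extension_split_extn:
  assumes "comm_group A" "comm_group C"
  shows "t_extension A C (split_extn A C)"
proof -
  interpret A: comm_group A by fact
  interpret C: comm_group C by fact
  interpret AC: comm_group "A \<times>\<times> C" by (intro comm_group_DirProd assms)
  interpret i: group_hom C "A \<times>\<times> C" "\<lambda>c. (\<one>\<^bsub>A\<^esub>, c)"
    by unfold_locales (auto simp: hom_def)
  have "c \<in> snd ` carrier (torsion (A \<times>\<times> C))" if "c \<in> carrier (torsion C)" for c
    using hom_torsion[OF i.group_hom_axioms that] by force
  then show ?thesis
    using extension_split_extn[OF assms] by (auto simp: t_extension_iff split_extn_def)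
qed

theorem theorem1p6:
  fixes A :: "'a monoid" and C :: "'c monoid"
    and E\<^sub>1 :: "('a, 'b1, 'c) extn" and E\<^sub>2 :: "('a, 'b2, 'c) extn"
  assumes "comm_group A" and "comm_group C"
  shows "group (Ext C A) \<and> subgroup (Ext_t C A) (Ext C A) \<and>
         (t_extension A C E\<^sub>1 \<longrightarrow> t_extension A C E\<^sub>2 \<longrightarrow>
            ext_class A C E\<^sub>1 \<otimes>\<^bsub>Ext C A\<^esub> ext_class A C E\<^sub>2
              = ext_class A C (baer_sum A C E\<^sub>1 E\<^sub>2))"
proof (intro conjI impI)
  show group: "group (Ext C A)"
    using assms by (rule group_Ext)
  show "subgroup (Ext_t C A) (Ext C A)"
  proof (rule group.subgroupI[OF group])
    show "Ext_t C A \<subseteq> carrier (Ext C A)"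
      by (auto simp: Ext_t_def)
    show "Ext_t C A \<noteq> {}"
      using ext_class_in_Ext_t_iff[OF extension_split_extn[OF assms]] t_extension_split_extn[OF assms]
      by blast
  next
    fix X assume "X \<in> Ext_t C A"
    then obtain E :: "('a, 'a \<times> 'c, 'c) extn" where E: "t_extension A C E" and X: "X = ext_class A C E"
      by (rule Ext_tE)
    then have "extension A C E" by (simp add: t_extension_iff)
    then show "inv\<^bsub>Ext C A\<^esub> X \<in> Ext_t C A"
      using t_extension_neg_extn[OF E] by (simp add: X inv_Ext ext_class_in_Ext_t_iff extension_neg_extn)
  next
    fix X Y assume XY: "X \<in> Ext_t C A" "Y \<in> Ext_t C A"
    obtain E :: "('a, 'a \<times> 'c, 'c) extn" where E: "t_extension A C E" and X: "X = ext_class A C E"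
      by (rule Ext_tE[OF XY(1)])
    obtain F :: "('a, 'a \<times> 'c, 'c) extn" where F: "t_extension A C F" and Y: "Y = ext_class A C F"
      by (rule Ext_tE[OF XY(2)])
    have "extension A C E" "extension A C F"
      using E F by (auto simp: t_extension_iff)
    then show "X \<otimes>\<^bsub>Ext C A\<^esub> Y \<in> Ext_t C A"
      using t_extension_baer_sum[OF E F]
      by (simp add: X Y ext_class_mult ext_class_in_Ext_t_iff extension_baer_sum)
  qed
  assume "t_extension A C E\<^sub>1" "t_extension A C E\<^sub>2"
  then show "ext_class A C E\<^sub>1 \<otimes>\<^bsub>Ext C A\<^esub> ext_class A C E\<^sub>2 = ext_class A C (baer_sum A C E\<^sub>1 E\<^sub>2)"
    by (intro ext_class_mult) (auto simp: t_extension_iff)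
qed

end
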